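(* Let $n\ge 2$ be an integer. For a function $f:\mathbb{R}\to\mathbb{R}$ of class $\mathcal{C}^n$ and a simple solution $s$ of $f(x)=0$, consider, for $x$ in a neighborhood of $s$, the canonical method $x\mapsto H_f^n(x)$ where $$H_f^n(x)= x+\sum_{i=1}^{n-1}\frac{(-1)^i}{i!}(f(x))^i\,(f^{-1})^{(i)}(f(x))=:H^n\big(x,f(x),f'(x),f''(x),\ldots,f^{(n-1)}(x)\big).$$ The following holds. (i) The function $H^n$ of $n+1$ real variables, which does not depend on $f$, is a rational function with rational coefficients. (ii) The rational function $H^n$ is a polynomial function $P^n$ with integer coefficients in the new $n$ variables $$y_1=x,\quad y_2=\frac{f(x)}{f'(x)},\quad\text{and, when } n\ge 3,\quad y_j=\frac{f^{(j-1)}(x)}{(j-1)!\,f'(x)}\ \text{ for } j=3,4,\ldots,n,$$ that is, $H_f^n(x)=H^n(x,f(x),f'(x),\ldots,f^{(n-1)}(x))=P^n(y_1,y_2,\ldots,y_n)$ for some $P^n\in\mathbb{Z}[y_1,y_2,\ldots,y_n]$ of degree $2n-3$, with degree $n-1$ in the variable $y_2$. (iii) If $f$ is of class $\mathcal{C}^{2n-2}$, the canonical method $H_f^n$ has order at least $n$ towards $s$; moreover, if $(f^{-1})^{(n)}(0)\ne 0$, its order is exactly $n$. (iv) Any method of order at least $n$ of the form $x\mapsto H(x,f(x),f'(x),\ldots,f^{(n-1)}(x))$, that is, any Class I method $(H,\mathcal{W}_H)$ of order $n$, writes as $$H^n\big(x,f(x),f'(x),\ldots,f^{(n-1)}(x)\big)+(f(x))^n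 A\big(x,f(x),f'(x),\ldots,f^{(n-1)}(x)\big),$$ where $A:\mathcal{W}_H\to\mathbb{R}$ is a continuous function such that $(x_0,x_1,\ldots,x_n)\mapsto x_1^nA(x_0,x_1,\ldots,x_n)$ is of class $\mathcal{C}^n$.
   Context: A simple solution (simple zero) $s$ of $f(x)=0$ satisfies $f(s)=0$ and $f'(s)\neq 0$. Here $f^{-1}$ denotes the local inverse of $f$ near $s$ (so $f^{-1}(0)=s$) and $(f^{-1})^{(i)}$ its $i$-th derivative. Order: a map $h$ provides a suitable iterative method for finding $s$ if for any $x_0$ close enough to $s$ the sequence $x_{m+1}=h(x_m)$, $m\ge0$, satisfies $\lim_{m\to\infty}x_m=s$. The method has order $p>1$ towards $s$ if $\lim_{m\to\infty}\frac{|x_{m+1}-s|}{|x_m-s|^p}=K\neq0$, and order at least $p$ towards $s$ if this limit exists with $K\ge 0$. The limit is considered for sequences with $x_m\ne s$ for all $m$. Class I methods: for $n\ge2$ let $\Pi_n=\{(x_0,x_1,\ldots,x_n)\in\mathbb{R}^{n+1}: x_2\neq0\}$ and $\Gamma_n=\{(x_0,x_1,\ldots,x_n)\in\Pi_n: x_1=0\}$. A Class I method of order $n$ (to approximate simple zeros of real functions) is a pair $(H,\mathcal{W}_H)$ where $\mathcal{W}_H$ is an open neighborhood of $\Gamma_n$ in $\Pi_n$ and $H:\mathcal{W}_H\to\mathbb{R}$ is a $\mathcal{C}^n$ function such that: (a) $H(x_0,0,x_2,\ldots,x_n)=x_0$ for all $(x_0,0,x_2,\ldots,x_n)\in\Gamma_n$;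 (b) for any real $\mathcal{C}^{2n-2}$ function $f$, the map $H_f(x)=H(x,f(x),f'(x),\ldots,f^{(n-1)}(x))$, which is well defined in a neighborhood of any simple zero $s$ of $f$, satisfies $H_f^{(i)}(s)=0$ for every $i\in\{1,\ldots,n-1\}$; (c) if $(x_0,x_1,x_2,\ldots,x_n)\in\mathcal{W}_H$ then $(x_0,tx_1,x_2,\ldots,x_n)\in\mathcal{W}_H$ for all $t\in[0,1]$. *)

theory Defs
  imports "HOL-Analysis.Analysis" "HOL-Library.Poly_Mapping"
begin

subsection \<open>Smooth functions\<close>

definition Ck_real :: "nat \<Rightarrow> (real \<Rightarrow> real) \<Rightarrow> bool" where
  "Ck_real k f \<longleftrightarrow>
     (\<forall>i<k. \<forall>x. (deriv ^^ i) f differentiable at x) \<and> continuous_on UNIV ((deriv ^^ k) f)"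

text \<open>Only meant for open \<open>S\<close>: the Frechet derivatives are taken in the whole space.
  In the successor step, \<open>F\<close> is differentiable and each directional derivative of \<open>F\<close> is
  of class \<open>C\<^sup>k\<close>; in finite dimension this says that the derivative itself is \<open>C\<^sup>k\<close>.\<close>

primrec Ck_on :: "nat \<Rightarrow> 'a::euclidean_space set \<Rightarrow> ('a \<Rightarrow> real) \<Rightarrow> bool" where
  "Ck_on 0 S F \<longleftrightarrow> continuous_on S F"
| "Ck_on (Suc k) S F \<longleftrightarrow>
     (\<forall>x\<in>S. F differentiable at x) \<and> (\<forall>v. Ck_on k S (\<lambda>x. frechet_derivative F (at x) v))"


subsection \<open>Simple zeros, local inverses and the canonical method\<close>

definition simple_zero :: "(real \<Rightarrow> real) \<Rightarrow> real \<Rightarrow> bool" where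
  "simple_zero f s \<longleftrightarrow> f s = 0 \<and> deriv f s \<noteq> 0"

text \<open>The function \<open>g\<close> is the inverse of \<open>f\<close> on the neighbourhood \<open>U\<close> of \<open>s\<close>.  Its values
  outside the open set \<open>f ` U\<close> are arbitrary and do not influence its derivatives there.\<close>

definition local_inverse :: "(real \<Rightarrow> real) \<Rightarrow> real \<Rightarrow> real set \<Rightarrow> (real \<Rightarrow> real) \<Rightarrow> bool" where
  "local_inverse f s U g \<longleftrightarrow>
     open U \<and> s \<in> U \<and> (\<forall>x\<in>U. deriv f x \<noteq> 0) \<and> (\<forall>x\<in>U. g (f x) = x)"

lemma local_inverse_exists:
  assumes "Ck_real n f" "n \<ge> 1" "simple_zero f s"
  shows "\<exists>U g. local_inverse f s U g"
proof -
  have d: "f differentiable at x" for x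
    using assms(1,2) unfolding Ck_real_def by (metis One_nat_def Suc_le_eq funpow_0)
  have c: "isCont (deriv f) s"
  proof (cases "n = 1")
    case True
    then show ?thesis
      using assms(1) by (simp add: Ck_real_def continuous_on_eq_continuous_at)
  next
    case False
    then have "(deriv ^^ 1) f differentiable at s"
      using assms(1,2) unfolding Ck_real_def by (metis le_neq_implies_less)
    then show ?thesis by (simp add: differentiable_imp_continuous_within)
  qed
  have "deriv f s \<noteq> 0" using assms(3) by (simp add: simple_zero_def)
  with c obtain e where e: "e > 0" "\<And>x. dist s x < e \<Longrightarrow> deriv f x \<noteq> 0"
    using continuous_at_avoid by blast
  define U where "U = ball s e"
  have der: "(f has_real_derivative deriv f x) (at x)" for x
    using d by (simp add: DERIV_deriv_iff_real_differentiable)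
  have neq: "f x \<noteq> f y" if "x \<in> U" "y \<in> U" "x < y" for x y
  proof
    assume "f x = f y"
    obtain z where z: "x < z" "z < y" "f y - f x = (y - x) * deriv f z"
      using MVT2[OF \<open>x < y\<close>, of f "deriv f"] der by blast
    have "z \<in> U" using that z(1,2) by (auto simp: U_def dist_real_def)
    then have "deriv f z \<noteq> 0" using e(2) by (auto simp: U_def)
    with z(3) \<open>f x = f y\<close> \<open>x < y\<close> show False by simp
  qed
  have "inj_on f U"
    by (rule inj_onI) (metis neq linorder_less_linear)
  then have "local_inverse f s U (inv_into U f)"
    using e by (auto simp: local_inverse_def U_def)
  then show ?thesis by blast
qed

definition canonical_method :: "nat \<Rightarrow> (real \<Rightarrow> real) \<Rightarrow> (real \<Rightarrow> real) \<Rightarrow> real \<Rightarrow> real" where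
  "canonical_method n f g x =
     x + (\<Sum>i=1..n-1. (-1) ^ i / fact i * f x ^ i * (deriv ^^ i) g (f x))"


subsection \<open>Order of an iterative method\<close>

definition suitable_method :: "(real \<Rightarrow> real) \<Rightarrow> real \<Rightarrow> bool" where
  "suitable_method h s \<longleftrightarrow> (\<forall>\<^sub>F x0 in nhds s. (\<lambda>m. (h ^^ m) x0) \<longlonglongrightarrow> s)"

definition error_limit :: "(real \<Rightarrow> real) \<Rightarrow> real \<Rightarrow> real \<Rightarrow> real \<Rightarrow> bool" where
  "error_limit h p s K \<longleftrightarrow>
     (\<forall>\<^sub>F x0 in nhds s. (\<forall>m. (h ^^ m) x0 \<noteq> s) \<longrightarrow>
        (\<lambda>m. \<bar>(h ^^ Suc m) x0 - s\<bar> / \<bar>(h ^^ m) x0 - s\<bar> powr p) \<longlonglongrightarrow> K)"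

definition order_at_least :: "(real \<Rightarrow> real) \<Rightarrow> real \<Rightarrow> real \<Rightarrow> bool" where
  "order_at_least h p s \<longleftrightarrow> p > 1 \<and> suitable_method h s \<and> (\<exists>K\<ge>0. error_limit h p s K)"

text \<open>The last conjunct prevents a map all of whose orbits reach \<open>s\<close> exactly, such as the
  constant map \<open>s\<close>, from having every order vacuously.\<close>

definition has_order :: "(real \<Rightarrow> real) \<Rightarrow> real \<Rightarrow> real \<Rightarrow> bool" where
  "has_order h p s \<longleftrightarrow> p > 1 \<and> suitable_method h s \<and> (\<exists>K. K \<noteq> 0 \<and> error_limit h p s K) \<and>
     (\<exists>\<^sub>F x0 in nhds s. \<forall>m. (h ^^ m) x0 \<noteq> s)"


subsection \<open>Polynomials in the variables with indices in \<open>nat\<close>\<close>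

text \<open>A monomial is a finitely supported map from variables to exponents, and a polynomial
  a finitely supported map from monomials to coefficients.\<close>

type_synonym 'a mpoly = "(nat \<Rightarrow>\<^sub>0 nat) \<Rightarrow>\<^sub>0 'a"

definition mpoly_vars :: "'a::zero mpoly \<Rightarrow> nat set" where
  "mpoly_vars p = (\<Union>m\<in>Poly_Mapping.keys p. Poly_Mapping.keys m)"

definition mpoly_eval :: "('a::zero \<Rightarrow> real) \<Rightarrow> 'a mpoly \<Rightarrow> (nat \<Rightarrow> real) \<Rightarrow> real" where
  "mpoly_eval c p a =
     (\<Sum>m\<in>Poly_Mapping.keys p. c (Poly_Mapping.lookup p m) *
        (\<Prod>i\<in>Poly_Mapping.keys m. a i ^ Poly_Mapping.lookup m i))"

definition mpoly_degree :: "'a::zero mpoly \<Rightarrow> nat" where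
  "mpoly_degree p =
     Max (insert 0 ((\<lambda>m. \<Sum>i\<in>Poly_Mapping.keys m. Poly_Mapping.lookup m i) ` Poly_Mapping.keys p))"

definition mpoly_degree_in :: "nat \<Rightarrow> 'a::zero mpoly \<Rightarrow> nat" where
  "mpoly_degree_in j p = Max (insert 0 ((\<lambda>m. Poly_Mapping.lookup m j) ` Poly_Mapping.keys p))"


subsection \<open>Class I methods\<close>

text \<open>The space of points \<open>(x\<^sub>0, \<dots>, x\<^sub>n)\<close> is \<open>real ^ 'd\<close>, where \<open>idx\<close> is a bijection from
  \<open>{..n}\<close> to \<open>'d\<close>: the coordinate \<open>x\<^sub>k\<close> of \<open>v\<close> is \<open>v $ idx k\<close>.\<close>

definition point :: "(nat \<Rightarrow> 'd::finite) \<Rightarrow> nat \<Rightarrow> (nat \<Rightarrow> real) \<Rightarrow> real ^ 'd" where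
  "point idx n a = (\<chi> c. a (inv_into {..n} idx c))"

lemma point_nth:
  assumes "bij_betw idx {..n} UNIV" "k \<le> n"
  shows "point idx n a $ idx k = a k"
  using assms by (simp add: point_def bij_betw_inv_into_left)

text \<open>The point \<open>(x, f x, f' x, \<dots>, f\<^bsup>(n-1)\<^esup> x)\<close>.\<close>

definition jet :: "(nat \<Rightarrow> 'd::finite) \<Rightarrow> nat \<Rightarrow> (real \<Rightarrow> real) \<Rightarrow> real \<Rightarrow> real ^ 'd" where
  "jet idx n f x = point idx n (\<lambda>k. case k of 0 \<Rightarrow> x | Suc j \<Rightarrow> (deriv ^^ j) f x)"

definition Pi_set :: "(nat \<Rightarrow> 'd::finite) \<Rightarrow> (real ^ 'd) set" where
  "Pi_set idx = {v. v $ idx 2 \<noteq> 0}"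

definition Gamma_set :: "(nat \<Rightarrow> 'd::finite) \<Rightarrow> (real ^ 'd) set" where
  "Gamma_set idx = {v \<in> Pi_set idx. v $ idx 1 = 0}"

definition class_I ::
  "(nat \<Rightarrow> 'd::finite) \<Rightarrow> nat \<Rightarrow> (real ^ 'd \<Rightarrow> real) \<Rightarrow> (real ^ 'd) set \<Rightarrow> bool" where
  "class_I idx n H W \<longleftrightarrow>
     openin (top_of_set (Pi_set idx)) W \<and> Gamma_set idx \<subseteq> W \<and> Ck_on n W H \<and>
     (\<forall>v\<in>Gamma_set idx. H v = v $ idx 0) \<and>
     (\<forall>f s. Ck_real (2 * n - 2) f \<longrightarrow> simple_zero f s \<longrightarrow>
        (\<forall>i\<in>{1..n-1}. (deriv ^^ i) (\<lambda>x. H (jet idx n f x)) s = 0)) \<and>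
     (\<forall>v\<in>W. \<forall>t\<in>{0..1}. point idx n ((\<lambda>k. v $ idx k)(1 := t * v $ idx 1)) \<in> W)"

end

theory Submission
  imports Defs "HOL-Computational_Algebra.Polynomial_FPS" "HOL-Library.Landau_Symbols"
begin

text \<open>Expanding \<open>g (f u) = u\<close> at \<open>x\<close>, for the local inverse \<open>g\<close> of \<open>f\<close>, shows that
  \<open>g\<^bsup>(i)\<^esup> (f x) f' x ^ i / i!\<close> is the \<open>i\<close>-th coefficient of the compositional inverse of the series
  \<open>h + y\<^sub>3 h\<^sup>2 + y\<^sub>4 h\<^sup>3 + \<dots>\<close>, hence an integer polynomial in \<open>y\<^sub>3, y\<^sub>4, \<dots>\<close>; it has weight \<open>i - 1\<close>
  if \<open>y\<^bsub>j+1\<^esub>\<close> has weight \<open>j - 1\<close>. The degrees are attained because for \<open>h - h\<^sup>2\<close> the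
  coefficients are the Catalan numbers. The order of the method is read off Taylor's formula for \<open>g\<close>
  between \<open>f x\<close> and \<open>0\<close>.

  For a Class I method \<open>H\<close> put \<open>D = H - H\<^sup>n\<close>. If the derivatives of \<open>D\<close> in the direction
  \<open>x\<^sub>1\<close> of order less than \<open>i\<close> vanish on \<open>\<Gamma>\<^sub>n\<close>, then \<open>D = x\<^sub>1\<^sup>i B\<close> with \<open>B\<close> continuous. If
  \<open>i < n\<close>, evaluating along the jet of a polynomial with a prescribed jet at its simple zero \<open>s\<close>, where \<open>D\<close> is
  \<open>o((u - s)\<^bsup>n-1\<^esup>)\<close>, gives \<open>B = 0\<close> on \<open>\<Gamma>\<^sub>n\<close>, so the derivative of order \<open>i\<close> vanishes as well. For
  \<open>i = n\<close> the quotient \<open>B\<close> is the required function \<open>A\<close>.\<close>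

section \<open>Calculus of \<open>C\<^sup>k\<close> functions\<close>

lemma Ck_on_Suc_imp: "Ck_on (Suc k) S F \<Longrightarrow> Ck_on k S F"
proof (induction k arbitrary: F)
  case 0
  then show ?case
    by (auto intro: continuous_at_imp_continuous_on simp: differentiable_imp_continuous_within)
next
  case (Suc k)
  then show ?case by (metis Ck_on.simps(2))
qed

lemma Ck_on_mono: "Ck_on k S F \<Longrightarrow> j \<le> k \<Longrightarrow> Ck_on j S F"
proof (induction k)
  case (Suc k)
  then show ?case by (metis Ck_on_Suc_imp le_SucE)
qed simp

lemma Ck_on_imp_continuous_on: "Ck_on k S F \<Longrightarrow> continuous_on S F"
  using Ck_on_mono[of k S F 0] by simp

lemma Ck_on_subset: "Ck_on k S F \<Longrightarrow> T \<subseteq> S \<Longrightarrow> Ck_on k T F"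
  by (induction k arbitrary: F) (auto intro: continuous_on_subset)

lemma Ck_on_cong:
  assumes "open S" "\<And>x. x \<in> S \<Longrightarrow> F x = G x" "Ck_on k S F"
  shows "Ck_on k S G"
  using assms(2,3)
proof (induction k arbitrary: F G)
  case 0
  then show ?case by (simp cong: continuous_on_cong)
next
  case (Suc k)
  have "G differentiable at x" if "x \<in> S" for x
  proof -
    obtain F' where "(F has_derivative F') (at x)"
      using Suc.prems(2) \<open>x \<in> S\<close> by (auto simp: differentiable_def)
    then have "(G has_derivative F') (at x)"
      using assms(1) \<open>x \<in> S\<close> Suc.prems(1) by (rule has_derivative_transform_within_open)
    then show ?thesis by (auto simp: differentiable_def)
  qed
  moreover have "Ck_on k S (\<lambda>x. frechet_derivative G (at x) v)" for v
  proof (rule Suc.IH)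
    show "Ck_on k S (\<lambda>x. frechet_derivative F (at x) v)" using Suc.prems by simp
    show "frechet_derivative F (at x) v = frechet_derivative G (at x) v" if "x \<in> S" for x
      using frechet_derivative_transform_within_open[of F x S G] Suc.prems that \<open>open S\<close> by simp
  qed
  ultimately show ?case by simp
qed

text \<open>Derivatives are unique, so any explicit formula \<open>F'\<close> may stand in for
  \<open>frechet_derivative\<close>. Most closure rules below are proved by supplying such a
  formula.\<close>

lemma Ck_on_SucI:
  assumes "open S"
    and "\<And>x. x \<in> S \<Longrightarrow> (F has_derivative F' x) (at x)"
    and "\<And>v. Ck_on k S (\<lambda>x. F' x v)"
  shows "Ck_on (Suc k) S F"
proof -
  have "F' x v = frechet_derivative F (at x) v" if "x \<in> S" for x v
    using frechet_derivative_at[OF assms(2)[OF that]] by simp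
  then have "Ck_on k S (\<lambda>x. frechet_derivative F (at x) v)" for v
    by (rule Ck_on_cong[OF assms(1) _ assms(3)[of v]])
  then show ?thesis using assms(2) by (auto simp: differentiable_def)
qed

lemma Ck_on_SucD:
  assumes "Ck_on (Suc k) S F" "x \<in> S"
  shows "(F has_derivative frechet_derivative F (at x)) (at x)"
  using assms by (simp add: frechet_derivative_works)

lemma Ck_on_const: "open S \<Longrightarrow> Ck_on k S (\<lambda>_. c)"
proof (induction k arbitrary: c)
  case (Suc k)
  then show ?case by (intro Ck_on_SucI[where F' = "\<lambda>_ _. 0"]) auto
qed simp

lemma Ck_on_bounded_linear:
  assumes "open S" "bounded_linear F"
  shows "Ck_on k S F"
proof (cases k)
  case 0
  then show ?thesis using assms by (simp add: linear_continuous_on)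
next
  case (Suc j)
  show ?thesis
    unfolding Suc
    by (rule Ck_on_SucI[OF assms(1) bounded_linear_imp_has_derivative[OF assms(2)]
          Ck_on_const[OF assms(1)]])
qed

lemma Ck_on_add:
  assumes "open S" "Ck_on k S F" "Ck_on k S G"
  shows "Ck_on k S (\<lambda>x. F x + G x)"
  using assms(2,3)
proof (induction k arbitrary: F G)
  case 0
  then show ?case by (auto intro: continuous_intros)
next
  case (Suc k)
  show ?case
    using Suc.prems
    by (intro Ck_on_SucI[OF assms(1), where F' = "\<lambda>x v. frechet_derivative F (at x) v +
          frechet_derivative G (at x) v"] has_derivative_add Suc.IH)
       (auto intro: Ck_on_SucD)
qed

text \<open>The product rule involves the factors themselves besides their derivatives; hence the
  use of \<open>Ck_on_Suc_imp\<close> on the premises.\<close>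

lemma Ck_on_mult:
  assumes "open S" "Ck_on k S F" "Ck_on k S G"
  shows "Ck_on k S (\<lambda>x. F x * G x)"
  using assms(2,3)
proof (induction k arbitrary: F G)
  case 0
  then show ?case by (auto intro: continuous_intros)
next
  case (Suc k)
  show ?case
    using Suc.prems Suc.prems[THEN Ck_on_Suc_imp]
    by (intro Ck_on_SucI[OF assms(1), where F' = "\<lambda>x v. F x * frechet_derivative G (at x) v +
          frechet_derivative F (at x) v * G x"] has_derivative_mult Suc.IH Ck_on_add assms)
       (auto intro: Ck_on_SucD)
qed

lemma Ck_on_diff:
  assumes "open S" "Ck_on k S F" "Ck_on k S G"
  shows "Ck_on k S (\<lambda>x. F x - G x)"
  using Ck_on_add[OF assms(1,2) Ck_on_mult[OF assms(1) Ck_on_const[OF assms(1)] assms(3), of "-1"]]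
  by simp

lemma Ck_on_sum:
  assumes "open S" "\<And>i. i \<in> I \<Longrightarrow> Ck_on k S (F i)"
  shows "Ck_on k S (\<lambda>x. \<Sum>i\<in>I. F i x)"
  using assms(2)
  by (induction I rule: infinite_finite_induct) (auto intro: Ck_on_const Ck_on_add assms(1))

lemma Ck_on_prod:
  assumes "open S" "\<And>i. i \<in> I \<Longrightarrow> Ck_on k S (F i)"
  shows "Ck_on k S (\<lambda>x. \<Prod>i\<in>I. F i x)"
  using assms(2)
  by (induction I rule: infinite_finite_induct) (auto intro: Ck_on_const Ck_on_mult assms(1))

lemma Ck_on_power:
  assumes "open S" "Ck_on k S F"
  shows "Ck_on k S (\<lambda>x. F x ^ m)"
  by (induction m) (auto intro: Ck_on_const Ck_on_mult assms)

text \<open>Chain rule in coordinates: the derivative is a sum over \<open>Basis\<close> of a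
  component derivative of \<gamma> times a partial derivative of \<open>F\<close> composed with
  \<gamma>. The induction hypothesis is applied to these partial derivatives.\<close>

lemma Ck_on_compose:
  fixes \<gamma> :: "'b::euclidean_space \<Rightarrow> 'a::euclidean_space"
  assumes "open S" "Ck_on k T F" "\<And>b. b \<in> Basis \<Longrightarrow> Ck_on k S (\<lambda>x. \<gamma> x \<bullet> b)"
    and "\<gamma> ` S \<subseteq> T"
  shows "Ck_on k S (\<lambda>x. F (\<gamma> x))"
  using assms(2,3)
proof (induction k arbitrary: F)
  case 0
  have "continuous_on S \<gamma>"
    using 0 by (subst continuous_on_componentwise) auto
  then show ?case using 0 assms(4) by (simp add: continuous_on_compose2)
next
  case (Suc k)
  define D where "D x v = (\<Sum>b\<in>Basis. frechet_derivative (\<lambda>x. \<gamma> x \<bullet> b) (at x) v *\<^sub>R b)" for x v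
  have \<gamma>: "(\<gamma> has_derivative D x) (at x)" if "x \<in> S" for x
  proof (subst has_derivative_componentwise_within, rule ballI)
    fix b :: 'a assume b: "b \<in> Basis"
    have "D x v \<bullet> b = frechet_derivative (\<lambda>x. \<gamma> x \<bullet> b) (at x) v" for v
      unfolding D_def by (rule inner_sum_left_Basis[OF b])
    then show "((\<lambda>x. \<gamma> x \<bullet> b) has_derivative (\<lambda>v. D x v \<bullet> b)) (at x)"
      using Ck_on_SucD[OF Suc.prems(2)[OF b] that] by simp
  qed
  let ?F' = "\<lambda>x. frechet_derivative F (at (\<gamma> x))"
  show ?case
  proof (rule Ck_on_SucI[OF assms(1)])
    fix x assume x: "x \<in> S"
    then have F: "(F has_derivative ?F' x) (at (\<gamma> x))"
      using Ck_on_SucD[OF Suc.prems(1)] assms(4) by blast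
    from has_derivative_compose[OF \<gamma>[OF x] F]
    have "((\<lambda>x. F (\<gamma> x)) has_derivative (\<lambda>v. ?F' x (D x v))) (at x)" .
    moreover have "?F' x (D x v) =
        (\<Sum>b\<in>Basis. frechet_derivative (\<lambda>x. \<gamma> x \<bullet> b) (at x) v * ?F' x b)" for v
      using has_derivative_linear[OF F] by (simp add: D_def linear_sum linear_scale)
    ultimately show "((\<lambda>x. F (\<gamma> x)) has_derivative
        (\<lambda>v. \<Sum>b\<in>Basis. frechet_derivative (\<lambda>x. \<gamma> x \<bullet> b) (at x) v * ?F' x b)) (at x)"
      by simp
  next
    show "Ck_on k S (\<lambda>x. \<Sum>b\<in>Basis. frechet_derivative (\<lambda>x. \<gamma> x \<bullet> b) (at x) v * ?F' x b)" for v
    proof (rule Ck_on_sum[OF assms(1)], rule Ck_on_mult[OF assms(1)])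
      fix b :: 'a assume b: "b \<in> Basis"
      show "Ck_on k S (\<lambda>x. frechet_derivative (\<lambda>x. \<gamma> x \<bullet> b) (at x) v)"
        using Suc.prems(2)[OF b] by simp
      have "Ck_on k T (\<lambda>y. frechet_derivative F (at y) b)" using Suc.prems(1) by simp
      then show "Ck_on k S (\<lambda>x. ?F' x b)"
        by (rule Suc.IH) (rule Ck_on_Suc_imp[OF Suc.prems(2)])
    qed
  qed
qed

lemma Ck_on_compose_real:
  fixes \<gamma> :: "'b::euclidean_space \<Rightarrow> real"
  assumes "open S" "Ck_on k T F" "Ck_on k S \<gamma>" "\<gamma> ` S \<subseteq> T"
  shows "Ck_on k S (\<lambda>x. F (\<gamma> x))"
  using assms by (intro Ck_on_compose[OF assms(1,2) _ assms(4)]) simp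

text \<open>The derivative of \<open>inverse\<close> is a product of copies of
  \<open>inverse\<close> and a constant, so the induction feeds on itself.\<close>

lemma Ck_on_inverse_real: "Ck_on k (- {0}) (inverse :: real \<Rightarrow> real)"
proof (induction k)
  case 0
  then show ?case by (auto intro!: continuous_intros)
next
  case (Suc k)
  have o: "open (- {0 :: real})" by auto
  show ?case
  proof (rule Ck_on_SucI[OF o, where F' = "\<lambda>x v. - (inverse x * v * inverse x)"])
    fix x :: real assume "x \<in> - {0}"
    then show "(inverse has_derivative (\<lambda>v. - (inverse x * v * inverse x))) (at x)"
      by (intro has_derivative_inverse') auto
  next
    fix v :: real
    have "Ck_on k (- {0}) (\<lambda>x. (- v) * (inverse x * inverse x))"
      by (rule Ck_on_mult[OF o Ck_on_const[OF o] Ck_on_mult[OF o Suc Suc]])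
    then show "Ck_on k (- {0}) (\<lambda>x. - (inverse x * v * inverse x))"
      by (simp add: mult_ac)
  qed
qed

lemma Ck_on_inverse:
  assumes "open S" "Ck_on k S F" "\<And>x. x \<in> S \<Longrightarrow> F x \<noteq> 0"
  shows "Ck_on k S (\<lambda>x. inverse (F x))"
  by (rule Ck_on_compose_real[OF assms(1) Ck_on_inverse_real assms(2)]) (use assms(3) in auto)

lemma Ck_on_divide:
  assumes "open S" "Ck_on k S F" "Ck_on k S G" "\<And>x. x \<in> S \<Longrightarrow> G x \<noteq> 0"
  shows "Ck_on k S (\<lambda>x. F x / G x)"
  unfolding divide_inverse using assms by (intro Ck_on_mult Ck_on_inverse)

lemma Ck_on_Suc_real:
  fixes f :: "real \<Rightarrow> real"
  assumes "open S"
  shows "Ck_on (Suc k) S f \<longleftrightarrow> (\<forall>x\<in>S. f differentiable at x) \<and> Ck_on k S (deriv f)"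
proof (intro iffI conjI)
  have D: "(f has_derivative (\<lambda>v. deriv f x * v)) (at x)" if "f differentiable at x" for x
    using that by (metis DERIV_deriv_iff_real_differentiable has_field_derivative_def)
  then have E: "frechet_derivative f (at x) v = deriv f x * v" if "f differentiable at x" for x v
    using that frechet_derivative_at by (metis (no_types, lifting))
  {
    assume *: "Ck_on (Suc k) S f"
    then show "\<forall>x\<in>S. f differentiable at x" by simp
    have "Ck_on k S (\<lambda>x. frechet_derivative f (at x) 1)" using * by simp
    then show "Ck_on k S (deriv f)"
      by (rule Ck_on_cong[OF assms, rotated]) (use * E in auto)
  next
    assume *: "(\<forall>x\<in>S. f differentiable at x) \<and> Ck_on k S (deriv f)"
    show "Ck_on (Suc k) S f"
      by (rule Ck_on_SucI[OF assms, where F' = "\<lambda>x v. deriv f x * v"])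
         (use * D in \<open>auto intro!: Ck_on_mult Ck_on_const assms\<close>)
  }
qed

lemma Ck_real_Suc:
  "Ck_real (Suc k) f \<longleftrightarrow> (\<forall>x. f differentiable at x) \<and> Ck_real k (deriv f)"
proof -
  have "(\<forall>i<Suc k. \<forall>x. (deriv ^^ i) f differentiable at x) \<longleftrightarrow>
    (\<forall>x. f differentiable at x) \<and> (\<forall>i<k. \<forall>x. (deriv ^^ i) (deriv f) differentiable at x)"
    by (subst All_less_Suc2) (simp only: funpow_0 funpow_Suc_right o_apply)
  then show ?thesis
    unfolding Ck_real_def by (simp del: funpow.simps add: funpow_Suc_right)
qed

text \<open>Links the one-dimensional smoothness notion of the hypotheses to the calculus of
  \<open>Ck_on\<close>.\<close>

lemma Ck_real_iff_Ck_on: "Ck_real k f \<longleftrightarrow> Ck_on k UNIV f"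
proof (induction k arbitrary: f)
  case 0
  then show ?case by (simp add: Ck_real_def)
next
  case (Suc k)
  then show ?case by (simp add: Ck_real_Suc Ck_on_Suc_real del: Ck_on.simps)
qed

lemma Ck_on_funpow_deriv:
  assumes "open S" "Ck_on (i + k) S f"
  shows "Ck_on k S ((deriv ^^ i) f)"
  using assms(2)
proof (induction i arbitrary: f)
  case (Suc i)
  then show ?case
    using Ck_on_Suc_real[OF assms(1)] by (simp del: funpow.simps Ck_on.simps add: funpow_Suc_right)
qed simp

lemma Ck_on_has_real_derivative:
  assumes "open S" "Ck_on k S f" "i < k" "x \<in> S"
  shows "((deriv ^^ i) f has_real_derivative (deriv ^^ Suc i) f x) (at x)"
proof -
  have "Ck_on (Suc 0) S ((deriv ^^ i) f)"
    using assms by (intro Ck_on_funpow_deriv Ck_on_mono[OF assms(2)]) auto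
  then have "(deriv ^^ i) f differentiable at x" using assms(4) by simp
  then show ?thesis by (simp add: DERIV_deriv_iff_real_differentiable)
qed

lemma Ck_on_isCont:
  assumes "open S" "Ck_on k S f" "i \<le> k" "x \<in> S"
  shows "isCont ((deriv ^^ i) f) x"
proof -
  have "Ck_on (k - i) S ((deriv ^^ i) f)"
    using assms by (intro Ck_on_funpow_deriv) auto
  then show ?thesis
    using Ck_on_imp_continuous_on assms(1,4) continuous_on_eq_continuous_at by blast
qed

section \<open>Taylor's formula with Lagrange and Peano remainders\<close>

text \<open>The closed segment covers both positions of \<open>x\<close> relative to
  \<open>c\<close> and the degenerate cases \<open>k = 0\<close> and \<open>x = c\<close>. The
  family \<open>diff\<close> is kept abstract so that it can also consist of directional derivatives
  along a line.\<close>

lemma Taylor_closed_segment: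
  fixes diff :: "nat \<Rightarrow> real \<Rightarrow> real"
  assumes "\<And>m t. m < k \<Longrightarrow> t \<in> closed_segment c x \<Longrightarrow>
    (diff m has_real_derivative diff (Suc m) t) (at t)"
  shows "\<exists>\<xi>\<in>closed_segment c x.
    diff 0 x = (\<Sum>m<k. diff m c / fact m * (x - c) ^ m) + diff k \<xi> / fact k * (x - c) ^ k"
proof (cases "k = 0 \<or> x = c")
  case True
  then show ?thesis
  proof
    assume "k = 0" then show ?thesis by auto
  next
    assume "x = c"
    then show ?thesis
      by (cases k) (simp_all add: sum.lessThan_Suc_shift del: sum.lessThan_Suc)
  qed
next
  case False
  have "\<exists>t. (if x < c then x < t \<and> t < c else c < t \<and> t < x) \<and>
    diff 0 x = (\<Sum>m<k. diff m c / fact m * (x - c) ^ m) + diff k t / fact k * (x - c) ^ k"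
  proof (rule Taylor[where a = "min c x" and b = "max c x" and diff = diff])
    show "\<forall>m t. m < k \<and> min c x \<le> t \<and> t \<le> max c x \<longrightarrow>
       (diff m has_real_derivative diff (Suc m) t) (at t)"
      using assms
      by (auto simp: closed_segment_eq_real_ivl min_def max_def split: if_splits)
  qed (use False in auto)
  then show ?thesis
    by (auto simp: closed_segment_eq_real_ivl split: if_splits intro: less_imp_le)
qed

lemma Taylor_Lagrange:
  fixes f :: "real \<Rightarrow> real"
  assumes "open S" "Ck_on k S f" "closed_segment c x \<subseteq> S"
  shows "\<exists>\<xi>\<in>closed_segment c x.
    f x = (\<Sum>m<k. (deriv ^^ m) f c / fact m * (x - c) ^ m) + (deriv ^^ k) f \<xi> / fact k * (x - c) ^ k"
proof -
  have "\<exists>\<xi>\<in>closed_segment c x. (deriv ^^ 0) f x =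
      (\<Sum>m<k. (deriv ^^ m) f c / fact m * (x - c) ^ m) + (deriv ^^ k) f \<xi> / fact k * (x - c) ^ k"
    by (rule Taylor_closed_segment)
       (rule Ck_on_has_real_derivative[OF assms(1,2) _ subsetD[OF assms(3)]])
  then show ?thesis by (simp only: funpow_0)
qed

text \<open>The intermediate point of the Lagrange remainder is squeezed towards \<open>c\<close>,
  where the derivative of order \<open>k\<close> is continuous.\<close>

lemma Taylor_Peano:
  fixes f :: "real \<Rightarrow> real"
  assumes "open S" "Ck_on k S f" "c \<in> S"
  shows "((\<lambda>x. (f x - (\<Sum>m\<le>k. (deriv ^^ m) f c / fact m * (x - c) ^ m)) / (x - c) ^ k) \<longlongrightarrow> 0) (at c)"
proof -
  obtain r where r: "r > 0" "ball c r \<subseteq> S" using assms by (meson open_contains_ball)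
  have "\<forall>x\<in>ball c r. \<exists>\<xi>. \<bar>\<xi> - c\<bar> \<le> \<bar>x - c\<bar> \<and>
      f x = (\<Sum>m<k. (deriv ^^ m) f c / fact m * (x - c) ^ m) +
      (deriv ^^ k) f \<xi> / fact k * (x - c) ^ k"
  proof
    fix x assume x: "x \<in> ball c r"
    have "closed_segment c x \<subseteq> S"
      using x r by (intro order_trans[OF closed_segment_subset[OF _ _ convex_ball] r(2)]) auto
    from Taylor_Lagrange[OF assms(1,2) this] obtain \<xi> where "\<xi> \<in> closed_segment c x"
      and *: "f x = (\<Sum>m<k. (deriv ^^ m) f c / fact m * (x - c) ^ m) +
      (deriv ^^ k) f \<xi> / fact k * (x - c) ^ k" by blast
    then have "\<bar>\<xi> - c\<bar> \<le> \<bar>x - c\<bar>"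
      by (auto simp: closed_segment_eq_real_ivl split: if_splits)
    with * show "\<exists>\<xi>. \<bar>\<xi> - c\<bar> \<le> \<bar>x - c\<bar> \<and>
      f x = (\<Sum>m<k. (deriv ^^ m) f c / fact m * (x - c) ^ m) +
      (deriv ^^ k) f \<xi> / fact k * (x - c) ^ k" by blast
  qed
  \<comment> \<open>Choosing the intermediate points as a function of \<open>x\<close> makes it
    possible to take limits of them.\<close>
  from bchoice[OF this] obtain \<xi> where \<xi>: "\<And>x. x \<in> ball c r \<Longrightarrow> \<bar>\<xi> x - c\<bar> \<le> \<bar>x - c\<bar>"
    "\<And>x. x \<in> ball c r \<Longrightarrow> f x = (\<Sum>m<k. (deriv ^^ m) f c / fact m * (x - c) ^ m) +
      (deriv ^^ k) f (\<xi> x) / fact k * (x - c) ^ k" by blast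
  have ev: "\<forall>\<^sub>F x in at c. x \<in> ball c r"
    using r(1) by (metis centre_in_ball eventually_at_in_open' open_ball)
  have "((\<lambda>x. \<xi> x - c) \<longlongrightarrow> 0) (at c)"
  proof (rule Lim_null_comparison)
    show "\<forall>\<^sub>F x in at c. norm (\<xi> x - c) \<le> \<bar>x - c\<bar>"
      using ev by eventually_elim (simp add: \<xi>)
    show "((\<lambda>x. \<bar>x - c\<bar>) \<longlongrightarrow> 0) (at c)" 
      using tendsto_rabs_zero[OF LIM_zero[OF tendsto_ident_at]] by simp
  qed
  then have "(\<xi> \<longlongrightarrow> c) (at c)" by (simp add: LIM_zero_iff)
  then have "((\<lambda>x. (deriv ^^ k) f (\<xi> x)) \<longlongrightarrow> (deriv ^^ k) f c) (at c)"
    using Ck_on_isCont[OF assms(1,2) order_refl assms(3)] isCont_tendsto_compose by blast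
  then have "((\<lambda>x. ((deriv ^^ k) f (\<xi> x) - (deriv ^^ k) f c) / fact k) \<longlongrightarrow> 0) (at c)"
    by (auto intro!: tendsto_eq_intros)
  then show ?thesis
  proof (rule Lim_transform_eventually)
    show "\<forall>\<^sub>F x in at c. ((deriv ^^ k) f (\<xi> x) - (deriv ^^ k) f c) / fact k =
       (f x - (\<Sum>m\<le>k. (deriv ^^ m) f c / fact m * (x - c) ^ m)) / (x - c) ^ k"
      using ev eventually_neq_at_within[of c]
    proof eventually_elim
      case (elim x)
      then show ?case
        unfolding lessThan_Suc_atMost[symmetric] sum.lessThan_Suc by (subst \<xi>(2)) (auto simp: field_simps)
    qed
  qed
qed


section \<open>Weights and evaluation of polynomials\<close>

text \<open>A single weighted degree serves three purposes: constant weight 1 gives the total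
  degree, the indicator of one variable gives the degree in it, and the indicator of a complement
  tests which variables occur.\<close>

definition weight :: "(nat \<Rightarrow> nat) \<Rightarrow> (nat \<Rightarrow>\<^sub>0 nat) \<Rightarrow> nat" where
  "weight w m = (\<Sum>i\<in>Poly_Mapping.keys m. Poly_Mapping.lookup m i * w i)"

lemma weight_superset:
  assumes "finite S" "Poly_Mapping.keys m \<subseteq> S"
  shows "weight w m = (\<Sum>i\<in>S. Poly_Mapping.lookup m i * w i)"
  unfolding weight_def
  by (rule sum.mono_neutral_left) (use assms in \<open>auto simp: in_keys_iff\<close>)

lemma weight_add: "weight w (m + m') = weight w m + weight w m'"
proof -
  let ?S = "Poly_Mapping.keys m \<union> Poly_Mapping.keys m'"
  have "weight w (m + m') = (\<Sum>i\<in>?S. Poly_Mapping.lookup (m + m') i * w i)"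
    using keys_add[of m m'] by (intro weight_superset) auto
  then show ?thesis
    by (simp add: weight_superset[of ?S] lookup_add sum.distrib algebra_simps)
qed

lemma weight_zero [simp]: "weight w 0 = 0"
  by (simp add: weight_def)

lemma weight_single [simp]: "weight w (Poly_Mapping.single i k) = k * w i"
  by (simp add: weight_def)

definition weight_le :: "(nat \<Rightarrow> nat) \<Rightarrow> nat \<Rightarrow> 'a::zero mpoly \<Rightarrow> bool" where
  "weight_le w d p \<longleftrightarrow> (\<forall>m\<in>Poly_Mapping.keys p. weight w m \<le> d)"

lemma weight_le_mono: "weight_le w d p \<Longrightarrow> d \<le> d' \<Longrightarrow> weight_le w d' p"
  by (auto simp: weight_le_def intro: order_trans)

lemma weight_le_0 [simp]: "weight_le w d 0"
  by (simp add: weight_le_def)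

lemma weight_le_1 [simp]: "weight_le w d (1 :: 'a::comm_ring_1 mpoly)"
  by (simp add: weight_le_def)

lemma weight_le_add:
  "weight_le w d p \<Longrightarrow> weight_le w d q \<Longrightarrow> weight_le w d (p + q :: 'a::comm_ring_1 mpoly)"
  using keys_add[of p q] by (auto simp: weight_le_def)

lemma weight_le_diff:
  "weight_le w d p \<Longrightarrow> weight_le w d q \<Longrightarrow> weight_le w d (p - q :: 'a::comm_ring_1 mpoly)"
  unfolding weight_le_def by (metis Un_iff add_0_right diff_zero in_keys_iff lookup_minus)

lemma weight_le_uminus: "weight_le w d p \<Longrightarrow> weight_le w d (- p :: 'a::comm_ring_1 mpoly)"
  using weight_le_diff[of w d 0 p] by simp

lemma weight_le_sum:
  assumes "\<And>i. i \<in> I \<Longrightarrow> weight_le w d (f i)"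
  shows "weight_le w d (\<Sum>i\<in>I. f i :: 'a::comm_ring_1 mpoly)"
  using assms by (induction I rule: infinite_finite_induct) (auto intro: weight_le_add)

lemma weight_le_mult:
  "weight_le w d p \<Longrightarrow> weight_le w d' q \<Longrightarrow> weight_le w (d + d') (p * q :: 'a::comm_ring_1 mpoly)"
  using keys_mult[of p q] unfolding weight_le_def by (fastforce simp: weight_add intro: add_mono)

lemma weight_le_power:
  "weight_le w d p \<Longrightarrow> weight_le w (k * d) (p ^ k :: 'a::comm_ring_1 mpoly)"
  by (induction k) (auto intro: weight_le_mult)

lemma weight_le_minus_1_power: "weight_le w 0 ((- 1) ^ k :: 'a::comm_ring_1 mpoly)"
  using weight_le_power[of w 0 "0 - 1 :: 'a mpoly" k] weight_le_diff[OF weight_le_0 weight_le_1]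
  by fastforce

text \<open>Variables outside \<open>V\<close> have weight 1, so weight 0 excludes them. The closure
  rules for \<open>weight_le\<close> thereby control the variables as well.\<close>

lemma mpoly_vars_subset_iff:
  "mpoly_vars p \<subseteq> V \<longleftrightarrow> weight_le (\<lambda>i. if i \<in> V then 0 else 1) 0 p"
proof -
  have "Poly_Mapping.keys m \<subseteq> V \<longleftrightarrow> weight (\<lambda>i. if i \<in> V then 0 else 1) m = 0" for m
    unfolding weight_def by (subst sum_eq_0_iff) (auto simp: in_keys_iff)
  then show ?thesis by (auto simp: mpoly_vars_def weight_le_def)
qed

lemma Max_insert_0_image_eq:
  fixes f :: "'a \<Rightarrow> nat"
  assumes "finite S" "\<And>x. x \<in> S \<Longrightarrow> f x \<le> d" "0 < d \<Longrightarrow> \<exists>x\<in>S. d \<le> f x"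
  shows "Max (insert 0 (f ` S)) = d"
proof (rule Max_eqI)
  show "d \<in> insert 0 (f ` S)"
    using assms(2,3) by (cases "d = 0") (auto intro!: image_eqI dest: antisym)
qed (use assms(1,2) in auto)

text \<open>Sharpness is phrased as failure of the bound \<open>d\<close>, the form that
  \<open>not_weight_leI\<close> delivers.\<close>

lemma Max_weight_eq:
  assumes "weight_le w (Suc d) p" "\<not> weight_le w d p"
  shows "Max (insert 0 (weight w ` Poly_Mapping.keys p)) = Suc d"
  using assms by (intro Max_insert_0_image_eq) (auto simp: weight_le_def not_le Suc_le_eq)

lemma mpoly_degree_eqI:
  assumes "weight_le (\<lambda>_. 1) (Suc d) p" "\<not> weight_le (\<lambda>_. 1) d p"
  shows "mpoly_degree p = Suc d"
proof -
  have "weight (\<lambda>_. 1) = (\<lambda>m. \<Sum>i\<in>Poly_Mapping.keys m. Poly_Mapping.lookup m i)"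
    by (simp add: weight_def fun_eq_iff)
  with Max_weight_eq[OF assms] show ?thesis by (simp add: mpoly_degree_def)
qed

lemma mpoly_degree_in_eqI:
  assumes "weight_le (\<lambda>i. if i = j then 1 else 0) (Suc d) p"
    "\<not> weight_le (\<lambda>i. if i = j then 1 else 0) d p"
  shows "mpoly_degree_in j p = Suc d"
proof -
  have "weight (\<lambda>i. if i = j then 1 else 0) = (\<lambda>m. Poly_Mapping.lookup m j)"
    by (simp add: weight_def fun_eq_iff if_distrib sum.If_cases in_keys_iff cong: if_cong)
  with Max_weight_eq[OF assms] show ?thesis by (simp add: mpoly_degree_in_def)
qed


section \<open>Evaluation of polynomials as a ring homomorphism\<close>

definition monom_val :: "(nat \<Rightarrow> real) \<Rightarrow> (nat \<Rightarrow>\<^sub>0 nat) \<Rightarrow> real" where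
  "monom_val a m = (\<Prod>i\<in>Poly_Mapping.keys m. a i ^ Poly_Mapping.lookup m i)"

lemma monom_val_superset:
  assumes "finite S" "Poly_Mapping.keys m \<subseteq> S"
  shows "monom_val a m = (\<Prod>i\<in>S. a i ^ Poly_Mapping.lookup m i)"
  unfolding monom_val_def
  by (rule prod.mono_neutral_left) (use assms in \<open>auto simp: in_keys_iff\<close>)

lemma monom_val_add: "monom_val a (m + m') = monom_val a m * monom_val a m'"
proof -
  let ?S = "Poly_Mapping.keys m \<union> Poly_Mapping.keys m'"
  have "monom_val a (m + m') = (\<Prod>i\<in>?S. a i ^ Poly_Mapping.lookup (m + m') i)"
    using keys_add[of m m'] by (intro monom_val_superset) auto
  then show ?thesis
    by (simp add: monom_val_superset[of ?S] lookup_add power_add prod.distrib)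
qed

lemma mpoly_eval_altdef:
  "mpoly_eval c p a = (\<Sum>m\<in>Poly_Mapping.keys p. c (Poly_Mapping.lookup p m) * monom_val a m)"
  by (simp add: mpoly_eval_def monom_val_def)

definition mvar :: "nat \<Rightarrow> 'a::comm_ring_1 mpoly" where
  "mvar i = Poly_Mapping.single (Poly_Mapping.single i 1) 1"

lemma weight_le_mvar: "w i \<le> d \<Longrightarrow> weight_le w d (mvar i :: 'a::comm_ring_1 mpoly)"
  by (simp add: mvar_def weight_le_def)

text \<open>Treats integer and rational coefficients together; it is interpreted below with
  \<open>of_int\<close> and \<open>of_rat\<close>.\<close>

locale hom_to_real =
  fixes c :: "'a::comm_ring_1 \<Rightarrow> real"
  assumes c_add: "c (x + y) = c x + c y" and c_mult: "c (x * y) = c x * c y" and c_1: "c 1 = 1"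
begin

lemma c_0: "c 0 = 0"
  using c_add[of 0 0] by simp

lemma mpoly_eval_superset:
  assumes "finite S" "Poly_Mapping.keys p \<subseteq> S"
  shows "mpoly_eval c p a = (\<Sum>m\<in>S. c (Poly_Mapping.lookup p m) * monom_val a m)"
  unfolding mpoly_eval_altdef
  by (rule sum.mono_neutral_left) (use assms c_0 in \<open>auto simp: in_keys_iff\<close>)

lemma mpoly_eval_single: "mpoly_eval c (Poly_Mapping.single m x) a = c x * monom_val a m"
  by (simp add: mpoly_eval_superset[of "{m}"])

lemma mpoly_eval_0: "mpoly_eval c 0 a = 0"
  by (simp add: mpoly_eval_altdef)

lemma mpoly_eval_1: "mpoly_eval c 1 a = 1"
  by (simp add: mpoly_eval_altdef c_1 monom_val_def)

lemma mpoly_eval_mvar: "mpoly_eval c (mvar i) a = a i"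
  by (simp add: mvar_def mpoly_eval_single c_1 monom_val_def)

lemma mpoly_eval_add: "mpoly_eval c (p + q) a = mpoly_eval c p a + mpoly_eval c q a"
proof -
  let ?S = "Poly_Mapping.keys p \<union> Poly_Mapping.keys q"
  have "mpoly_eval c (p + q) a = (\<Sum>m\<in>?S. c (Poly_Mapping.lookup (p + q) m) * monom_val a m)"
    using keys_add[of p q] by (intro mpoly_eval_superset) auto
  then show ?thesis
    by (simp add: mpoly_eval_superset[of ?S] lookup_add c_add sum.distrib algebra_simps)
qed

lemma mpoly_eval_diff: "mpoly_eval c (p - q) a = mpoly_eval c p a - mpoly_eval c q a"
  using mpoly_eval_add[of "p - q" q a] by simp

lemma mpoly_eval_sum: "mpoly_eval c (\<Sum>i\<in>I. f i) a = (\<Sum>i\<in>I. mpoly_eval c (f i) a)"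
  by (induction I rule: infinite_finite_induct) (auto simp: mpoly_eval_0 mpoly_eval_add)

lemma mpoly_eval_mult: "mpoly_eval c (p * q) a = mpoly_eval c p a * mpoly_eval c q a"
proof -
  \<comment> \<open>Writing a polynomial as the sum of its terms reduces multiplicativity to
    products of monomials.\<close>
  have *: "(\<Sum>m\<in>Poly_Mapping.keys r. Poly_Mapping.single m (Poly_Mapping.lookup r m)) = r"
    for r :: "'a mpoly"
    by (rule poly_mapping_eqI) (simp add: lookup_sum lookup_single when_def in_keys_iff)
  have "mpoly_eval c (p * q) a = mpoly_eval c
      ((\<Sum>m\<in>Poly_Mapping.keys p. Poly_Mapping.single m (Poly_Mapping.lookup p m)) *
       (\<Sum>m\<in>Poly_Mapping.keys q. Poly_Mapping.single m (Poly_Mapping.lookup q m))) a"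
    by (simp only: *)
  also have "\<dots> = mpoly_eval c p a * mpoly_eval c q a"
    unfolding sum_product mult_single mpoly_eval_sum mpoly_eval_single c_mult monom_val_add
    by (simp add: mpoly_eval_altdef sum_product mult_ac)
  finally show ?thesis .
qed

lemma mpoly_eval_power: "mpoly_eval c (p ^ k) a = mpoly_eval c p a ^ k"
  by (induction k) (auto simp: mpoly_eval_1 mpoly_eval_mult)

lemma mpoly_eval_uminus: "mpoly_eval c (- p) a = - mpoly_eval c p a"
  using mpoly_eval_diff[of 0 p a] by (simp add: mpoly_eval_0)

end

text \<open>Substituting \<open>a i * t ^ w i\<close> turns a monomial of weight \<open>k\<close>
  into a constant multiple of \<open>t ^ k\<close>.\<close>

lemma mpoly_eval_scaled_eq_poly:
  assumes "weight_le w d p"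
  shows "\<exists>q. degree q \<le> d \<and> (\<forall>t. mpoly_eval c p (\<lambda>i. a i * t ^ w i) = poly q t)"
proof (intro exI conjI allI)
  let ?q = "\<Sum>m\<in>Poly_Mapping.keys p.
    Polynomial.monom (c (Poly_Mapping.lookup p m) * monom_val a m) (weight w m)"
  show "degree ?q \<le> d"
    using assms unfolding weight_le_def
    by (intro degree_sum_le) (auto intro: order_trans[OF degree_monom_le])
  have "monom_val (\<lambda>i. a i * t ^ w i) m = monom_val a m * t ^ weight w m" for t m
    by (simp add: monom_val_def weight_def power_mult_distrib prod.distrib power_sum
        mult.commute flip: power_mult)
  then show "mpoly_eval c p (\<lambda>i. a i * t ^ w i) = poly ?q t" for t
    by (simp add: mpoly_eval_altdef poly_sum poly_monom mult_ac)
qed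

text \<open>A test for lower degree bounds: if \<open>p\<close> had weight at most \<open>d\<close>,
  the substitution would give a polynomial in \<open>t\<close> of degree at most \<open>d\<close>,
  and real polynomials with equal values are equal.\<close>

lemma not_weight_leI:
  assumes "\<And>t. mpoly_eval c p (\<lambda>i. a i * t ^ w i) = poly r t" "coeff r (Suc d) \<noteq> 0"
  shows "\<not> weight_le w d p"
proof
  assume "weight_le w d p"
  from mpoly_eval_scaled_eq_poly[OF this, of c a] obtain q where
    q: "degree q \<le> d" "\<And>t. mpoly_eval c p (\<lambda>i. a i * t ^ w i) = poly q t" by blast
  then have "poly q = poly r" using assms(1) by (simp add: fun_eq_iff)
  then have "q = r" by (simp add: poly_eq_poly_eq_iff)
  then show False using q(1) assms(2) le_degree[of r "Suc d"] by simp
qed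


section \<open>Coefficients of the compositional inverse\<close>

text \<open>The series \<open>h + z 3 * h^2 + z 4 * h^3 + ...\<close>; the index shift matches the
  numbering of the variables \<open>y_j\<close>. With their values at \<open>x\<close> it is the
  formal expansion of \<open>(f (x + h) - f x) / f' x\<close>.\<close>

definition gen_series :: "(nat \<Rightarrow> 'r::comm_ring_1) \<Rightarrow> 'r fps" where
  "gen_series z = Abs_fps (\<lambda>j. if j = 0 then 0 else if j = 1 then 1 else z (Suc j))"

lemma gen_series_nth [simp]: "fps_nth (gen_series z) 0 = 0" "fps_nth (gen_series z) (Suc 0) = 1"
  by (simp_all add: gen_series_def)

lemma gen_series_power_nth:
  "k < i \<Longrightarrow> fps_nth (gen_series z ^ i) k = 0" "fps_nth (gen_series z ^ k) k = 1"
  using startsby_zero_power_prefix[of "gen_series z" i] startsby_zero_power_nth_same[of "gen_series z" k]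
  by simp_all

text \<open>The recursion compares coefficients in the requirement that the sum of
  \<open>inv_coeff z i * G ^ i\<close> equals \<open>h\<close>, where \<open>G\<close> is
  \<open>gen_series z\<close>. As \<open>G ^ k\<close> has coefficient 1 at \<open>k\<close>, no
  division occurs, so the definition makes sense over any commutative ring, in particular over
  integer polynomials.\<close>

function inv_coeff :: "(nat \<Rightarrow> 'r::comm_ring_1) \<Rightarrow> nat \<Rightarrow> 'r" where
  "inv_coeff z k = (if k = 1 then 1 else 0) -
     (\<Sum>i<k. inv_coeff z i * fps_nth (gen_series z ^ i) k)"
  by pat_completeness auto
termination by (relation "Wellfounded.measure snd") auto

declare inv_coeff.simps [simp del]

lemma inv_coeff_0 [simp]: "inv_coeff z 0 = 0"
  by (subst inv_coeff.simps) simp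

lemma inv_coeff_identity:
  "(\<Sum>i\<le>k. inv_coeff z i * fps_nth (gen_series z ^ i) k) = (if k = 1 then 1 else 0)"
  by (simp add: inv_coeff.simps[of z k] gen_series_power_nth(2) flip: lessThan_Suc_atMost)

text \<open>The system is triangular with unit diagonal. It is stated up to a bound \<open>N\<close>
  because a function of finite smoothness supplies only finitely many of these equations.\<close>

lemma inv_coeff_unique:
  assumes "\<And>k. k \<le> N \<Longrightarrow> (\<Sum>i\<le>k. C i * fps_nth (gen_series z ^ i) k) = (if k = 1 then 1 else 0)"
    and "k \<le> N"
  shows "C k = inv_coeff z k"
  using assms(2)
proof (induction k rule: less_induct)
  case (less k)
  have "(\<Sum>i<k. C i * fps_nth (gen_series z ^ i) k) =
      (\<Sum>i<k. inv_coeff z i * fps_nth (gen_series z ^ i) k)"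
    using less by (intro sum.cong) auto
  then show ?case
    using assms(1)[OF less.prems]
    by (simp add: inv_coeff.simps[of z k] gen_series_power_nth(2) algebra_simps
        flip: lessThan_Suc_atMost)
qed

lemma gen_series_power_cong:
  assumes "\<And>j. j \<le> N \<Longrightarrow> 2 \<le> j \<Longrightarrow> z (Suc j) = z' (Suc j)" "k \<le> N"
  shows "fps_nth (gen_series z ^ i) k = fps_nth (gen_series z' ^ i) k"
  using assms(2)
proof (induction i arbitrary: k)
  case (Suc i)
  have "fps_nth (gen_series z) j = fps_nth (gen_series z') j" if "j \<le> N" for j
    using assms(1) that by (auto simp: gen_series_def)
  then show ?case using Suc by (auto simp: fps_mult_nth intro!: sum.cong)
qed simp

text \<open>Only the entries of \<open>z\<close> with indices from 3 to \<open>k + 1\<close> enter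
  the coefficient of index \<open>k\<close>.\<close>

lemma inv_coeff_cong:
  assumes "\<And>j. j \<le> k \<Longrightarrow> 2 \<le> j \<Longrightarrow> z (Suc j) = z' (Suc j)"
  shows "inv_coeff z k = inv_coeff z' k"
proof (rule inv_coeff_unique[of k])
  fix m assume "m \<le> k"
  then show "(\<Sum>i\<le>m. inv_coeff z i * fps_nth (gen_series z' ^ i) m) = (if m = 1 then 1 else 0)"
    using inv_coeff_identity[of z m] gen_series_power_cong[of k z z' m] assms by simp
qed simp

text \<open>The recursion uses ring operations only. Applied to evaluation, this makes
  \<open>inv_coeff mvar\<close> a universal polynomial whose values are all the other
  coefficients.\<close>

lemma inv_coeff_hom:
  fixes h :: "'r::comm_ring_1 \<Rightarrow> 's::comm_ring_1"
  assumes "\<And>x y. h (x + y) = h x + h y" "\<And>x y. h (x * y) = h x * h y" "h 1 = 1"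
  shows "h (inv_coeff z k) = inv_coeff (\<lambda>j. h (z j)) k"
proof -
  have h0: "h 0 = 0" using assms(1)[of 0 0] by simp
  have hd: "h (x - y) = h x - h y" for x y using assms(1)[of "x - y" y] by simp
  have hs: "h (sum f I) = (\<Sum>i\<in>I. h (f i))" for f and I :: "nat set"
    by (induction I rule: infinite_finite_induct) (auto simp: h0 assms)
  have g: "h (fps_nth (gen_series z ^ i) k) = fps_nth (gen_series (\<lambda>j. h (z j)) ^ i) k" for i k
  proof (induction i arbitrary: k)
    case 0
    then show ?case by (simp add: h0 assms)
  next
    case (Suc i)
    have "h (fps_nth (gen_series z) j) = fps_nth (gen_series (\<lambda>j. h (z j))) j" for j
      by (simp add: gen_series_def h0 assms)
    then show ?case using Suc by (simp add: fps_mult_nth hs assms)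
  qed
  show ?thesis
  proof (induction k rule: less_induct)
    case (less k)
    then show ?case
      by (subst (1 2) inv_coeff.simps) (simp add: hd hs g h0 assms)
  qed
qed

lemma (in hom_to_real) mpoly_eval_inv_coeff:
  "mpoly_eval c (inv_coeff mvar k) a = inv_coeff a k"
  using inv_coeff_hom[of "\<lambda>p. mpoly_eval c p a" mvar k]
  by (simp add: mpoly_eval_add mpoly_eval_mult mpoly_eval_1 mpoly_eval_mvar)

text \<open>The bound for coefficient \<open>k\<close> of the power \<open>i\<close> of the series
  is \<open>(k - i) * e\<close>, because the excess of the degree over the number of factors is
  additive under products. Later \<open>e = 1\<close> serves the total degree, and
  \<open>e = 0\<close> the degree in \<open>y_2\<close> and the set of variables.\<close>

lemma weight_le_inv_coeff:
  assumes "\<And>j. 2 \<le> j \<Longrightarrow> j \<le> N \<Longrightarrow> w (Suc j) \<le> (j - 1) * e" "k \<le> N"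
  shows "weight_le w ((k - 1) * e) (inv_coeff mvar k :: 'a::comm_ring_1 mpoly)"
proof -
  let ?g = "gen_series mvar :: 'a mpoly fps"
  have g1: "weight_le w ((j - 1) * e) (fps_nth ?g j)" if "j \<le> N" for j
    using that assms(1)[of j] by (auto simp: gen_series_def intro!: weight_le_mvar)
  have g: "weight_le w ((k - i) * e) (fps_nth (?g ^ i) k)" if "k \<le> N" for i k
    using that
  proof (induction i arbitrary: k)
    case 0
    then show ?case by (cases "k = 0") auto
  next
    case (Suc i)
    have "weight_le w ((k - Suc i) * e) (fps_nth ?g l * fps_nth (?g ^ i) (k - l))" if "l \<le> k" for l
    \<comment> \<open>In these cases a factor vanishes; elsewhere the subtractions of naturals are
      not truncated and the excesses add up.\<close>
    proof (cases "l = 0 \<or> k - l < i")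
      case True
      then show ?thesis by (auto simp: gen_series_power_nth)
    next
      case False
      have "weight_le w ((l - 1) * e + (k - l - i) * e) (fps_nth ?g l * fps_nth (?g ^ i) (k - l))"
        using that Suc.prems by (intro weight_le_mult g1 Suc.IH) auto
      moreover have "(l - 1) + (k - l - i) = k - Suc i" using False that by auto
      ultimately show ?thesis by (metis add_mult_distrib)
    qed
    then show ?case by (auto simp: fps_mult_nth intro!: weight_le_sum)
  qed
  show ?thesis
    using assms(2)
  proof (induction k rule: less_induct)
    case (less k)
    have "weight_le w ((k - 1) * e) (inv_coeff mvar i * fps_nth (?g ^ i) k)" if "i < k" for i
    proof (cases "i = 0")
      case False
      have "weight_le w ((i - 1) * e + (k - i) * e) (inv_coeff mvar i * fps_nth (?g ^ i) k)"
        using that less by (intro weight_le_mult g less.IH) auto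
      moreover have "(i - 1) + (k - i) = k - 1" using False that by auto
      ultimately show ?thesis by (metis add_mult_distrib)
    qed simp
    then show ?case
      by (subst inv_coeff.simps) (auto intro!: weight_le_diff weight_le_uminus weight_le_sum)
  qed
qed


section \<open>The quadratic series and the Catalan numbers\<close>

text \<open>Here the series is \<open>h - t * h^2\<close>. Its inverse \<open>C\<close> satisfies
  \<open>C = h + t * C^2\<close>, and comparing coefficients gives the convolution
  recursion.\<close>

lemma inv_coeff_quadratic:
  fixes t :: real
  defines "C \<equiv> inv_coeff (\<lambda>j. if j = 3 then - t else 0)"
  shows "C 1 = 1" and "k \<ge> 2 \<Longrightarrow> C k = t * (\<Sum>i=0..k. C i * C (k - i))"
proof -
  let ?g = "gen_series (\<lambda>j. if j = 3 then - t else 0)"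
  let ?C = "Abs_fps C"
  have "?C oo ?g = fps_X"
    using inv_coeff_identity[of "\<lambda>j. if j = 3 then - t else 0"]
    by (simp add: fps_eq_iff fps_compose_nth C_def atLeast0AtMost)
  moreover have "?g oo fps_inv ?g = fps_X" by (rule fps_inv_right) auto
  moreover have i0: "fps_nth (fps_inv ?g) 0 = 0" by (simp add: fps_inv_def)
  \<comment> \<open>The defining identity makes \<open>?C\<close> a left inverse under composition;
    associativity identifies it with the right inverse, and the quadratic equation needs that
    side.\<close>
  ultimately have "?C = fps_inv ?g"
    using fps_compose_assoc[of "fps_inv ?g" ?g ?C] by (metis fps_X_fps_compose_startby0
        fps_compose_fps_X gen_series_nth(1))
  then have gC: "?g oo ?C = fps_X" by (metis \<open>?g oo fps_inv ?g = fps_X\<close>)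
  have C0: "fps_nth ?C 0 = 0" by (simp add: C_def)
  have "?g = fps_X - fps_const t * fps_X ^ 2"
    by (auto simp: fps_eq_iff gen_series_def fps_X_power_nth)
  then have "?C - fps_const t * ?C ^ 2 = fps_X"
    using gC C0 by (simp add: fps_compose_sub_distrib fps_compose_mult_distrib power2_eq_square)
  then have C: "?C = fps_X + fps_const t * (?C * ?C)" by (simp add: power2_eq_square algebra_simps)
  have eq: "C k = (if k = 1 then 1 else 0) + t * (\<Sum>i=0..k. C i * C (k - i))" for k
    using arg_cong[OF C, of "\<lambda>F. fps_nth F k"]
    unfolding fps_add_nth fps_mult_left_const_nth fps_mult_nth[of ?C] fps_nth_Abs_fps fps_X_nth .
  show "C 1 = 1" using C0 by (subst eq) simp
  show "C k = t * (\<Sum>i=0..k. C i * C (k - i))" if "k \<ge> 2"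
    using that by (subst eq) simp
qed

text \<open>These are the Catalan numbers, shifted by one index.\<close>

lemma inv_coeff_quadratic_pos:
  "k \<ge> 1 \<Longrightarrow> inv_coeff (\<lambda>j. if j = 3 then - 1 else 0) k > (0 :: real)"
proof (induction k rule: less_induct)
  case (less k)
  let ?C = "inv_coeff (\<lambda>j. if j = 3 then - 1 else 0) :: nat \<Rightarrow> real"
  have C1: "?C 1 = 1" using inv_coeff_quadratic(1)[of 1] by simp
  show ?case
  proof (cases "k = 1")
    case True
    then show ?thesis using C1 by simp
  next
    case False
    have nn: "?C i \<ge> 0" if "i < k" for i
      using less.IH[of i] that by (cases "i = 0") (auto intro: less_imp_le)
    have "0 < (\<Sum>i=0..k. ?C i * ?C (k - i))"
    proof (rule sum_pos2[of _ 1])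
      show "0 < ?C 1 * ?C (k - 1)" using less False C1 by simp
      \<comment> \<open>The terms at both ends vanish because \<open>?C 0 = 0\<close>, so only
        indices below \<open>k\<close> have to be nonnegative.\<close>
      show "0 \<le> ?C i * ?C (k - i)" if "i \<in> {0..k}" for i
        using that nn[of i] nn[of "k - i"] by (cases "i = 0 \<or> i = k") auto
    qed (use less in auto)
    moreover have "2 \<le> k" using False less.prems by simp
    ultimately show ?thesis using inv_coeff_quadratic(2)[of k 1] by simp
  qed
qed

text \<open>In the convolution recursion an inner term carries
  \<open>t ^ (i - 1) * t ^ (k - i - 1)\<close>, that is \<open>t ^ (k - 2)\<close>, and the
  prefactor supplies one more \<open>t\<close>.\<close>

lemma inv_coeff_quadratic_homogeneous:
  "inv_coeff (\<lambda>j. if j = 3 then - t else 0) k =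
     t ^ (k - 1) * inv_coeff (\<lambda>j. if j = 3 then - 1 else 0) k" for t :: real
proof (induction k rule: less_induct)
  case (less k)
  let ?C = "inv_coeff (\<lambda>j. if j = 3 then - 1 else 0) :: nat \<Rightarrow> real"
  let ?D = "inv_coeff (\<lambda>j. if j = 3 then - t else 0)"
  consider "k = 0" | "k = 1" | "k \<ge> 2" by linarith
  then show ?case
  proof cases
    case 3
    have "?D i * ?D (k - i) = t ^ (k - 2) * (?C i * ?C (k - i))" if "i \<in> {0..k}" for i
    proof (cases "i = 0 \<or> i = k")
      case False
      then have "i - 1 + (k - i - 1) = k - 2" using that by auto
      then show ?thesis using False that less[of i] less[of "k - i"]
        by (simp flip: power_add)
    qed auto
    then have "?D k = t * (\<Sum>i=0..k. t ^ (k - 2) * (?C i * ?C (k - i)))"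
      using inv_coeff_quadratic(2)[OF 3, of t] by simp
    also have "\<dots> = t * t ^ (k - 2) * ?C k"
      using inv_coeff_quadratic(2)[OF 3, of 1] by (simp add: sum_distrib_left mult_ac)
    also have "t * t ^ (k - 2) = t ^ (k - 1)"
      using 3 by (metis Suc_1 Suc_diff_Suc Suc_le_lessD One_nat_def power_Suc)
    finally show ?thesis .
  qed (use inv_coeff_quadratic(1) in auto)
qed


section \<open>The integer polynomial of the canonical method and its degrees\<close>

text \<open>This is \<open>P^n\<close>. The shape comes from splitting
  \<open>f^i * g^(i) / i!\<close> as \<open>(f / f')^i\<close> times
  \<open>g^(i) * f'^i / i!\<close>, whose second factor is the inverse coefficient of index
  \<open>i\<close>.\<close>

definition canonical_poly :: "nat \<Rightarrow> 'a::comm_ring_1 mpoly" where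
  "canonical_poly n = mvar 1 + (\<Sum>i=1..n-1. (- 1) ^ i * (mvar 2 ^ i * inv_coeff mvar i))"

lemma (in hom_to_real) mpoly_eval_canonical_poly:
  "mpoly_eval c (canonical_poly n) a = a 1 + (\<Sum>i=1..n-1. (- 1) ^ i * (a 2 ^ i * inv_coeff a i))"
  by (simp add: canonical_poly_def mpoly_eval_add mpoly_eval_sum mpoly_eval_mult mpoly_eval_mvar
      mpoly_eval_power mpoly_eval_uminus mpoly_eval_1 mpoly_eval_inv_coeff)

text \<open>The summand of index \<open>i\<close> has weight at most
  \<open>i * w 2 + (i - 1) * e\<close>. Both upper degree bounds and the bound on the variables are
  instances.\<close>

lemma weight_le_canonical_poly:
  assumes "\<And>j. 2 \<le> j \<Longrightarrow> j \<le> n - 1 \<Longrightarrow> w (Suc j) \<le> (j - 1) * e" "w 1 \<le> d"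
    and "\<And>i. 1 \<le> i \<Longrightarrow> i \<le> n - 1 \<Longrightarrow> i * w 2 + (i - 1) * e \<le> d"
  shows "weight_le w d (canonical_poly n :: 'a::comm_ring_1 mpoly)"
  unfolding canonical_poly_def
proof (intro weight_le_add weight_le_sum weight_le_mvar assms(2))
  fix i assume i: "i \<in> {1..n-1}"
  have "weight_le w (0 + (i * w 2 + (i - 1) * e))
      ((- 1) ^ i * (mvar 2 ^ i * inv_coeff mvar i :: 'a mpoly))"
    using i assms(1)
    by (intro weight_le_mult weight_le_minus_1_power weight_le_power weight_le_mvar
        weight_le_inv_coeff[of "n - 1"]) auto
  then show "weight_le w d ((- 1) ^ i * (mvar 2 ^ i * inv_coeff mvar i :: 'a mpoly))"
    using assms(3)[of i] i by (auto intro: weight_le_mono)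
qed

lemma mpoly_vars_canonical_poly:
  "n \<ge> 2 \<Longrightarrow> mpoly_vars (canonical_poly n :: 'a::comm_ring_1 mpoly) \<subseteq> {1..n}"
  unfolding mpoly_vars_subset_iff by (rule weight_le_canonical_poly[where e = 0]) auto

interpretation of_int: hom_to_real of_int
  by standard auto

interpretation of_rat: hom_to_real of_rat
  by standard (auto simp: of_rat_add of_rat_mult)

text \<open>The substitution \<open>y_2 = t\<close>, \<open>y_3 = - t\<close> and 0 elsewhere yields
  the sum of \<open>(- 1) ^ i * ?C i * t ^ (2 * i - 1)\<close>. Its top coefficient, at
  \<open>i = n - 1\<close>, is a Catalan number up to sign.\<close>

lemma mpoly_degree_canonical_poly:
  assumes "n \<ge> 2"
  shows "mpoly_degree (canonical_poly n :: int mpoly) = 2 * n - 3"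
proof -
  let ?P = "canonical_poly n :: int mpoly"
  let ?C = "inv_coeff (\<lambda>j. if j = 3 then - 1 else 0) :: nat \<Rightarrow> real"
  let ?a = "\<lambda>i::nat. if i = 2 then 1 else if i = 3 then - 1 else 0 :: real"
  let ?r = "\<Sum>i=1..n-1. Polynomial.monom ((- 1) ^ i * ?C i) (2 * i - 1)"
  have pos: "?C (n - 1) > 0"
    by (rule inv_coeff_quadratic_pos) (use assms in linarith)
  define d where "d = 2 * n - 4"
  have d: "2 * n - 3 = Suc d" using assms by (simp add: d_def)
  have "weight_le (\<lambda>_. 1) (Suc d) ?P"
    using assms by (intro weight_le_canonical_poly[where e = 1]) (auto simp: d_def)
  moreover have "\<not> weight_le (\<lambda>_. 1) d ?P"
  proof (rule not_weight_leI)
    fix t :: real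
    have "inv_coeff (\<lambda>j. ?a j * t ^ 1) i = inv_coeff (\<lambda>j. if j = 3 then - t else 0) i" for i
      by (rule inv_coeff_cong[of i]) auto
    moreover have "t ^ (i - 1) * t ^ i = t ^ (2 * i - 1)" if "i \<in> {1..n-1}" for i
      using that by (simp flip: power_add) (metis diff_add_assoc2 mult_2)
    ultimately show "mpoly_eval of_int ?P (\<lambda>i. ?a i * t ^ 1) = poly ?r t"
      by (auto simp: of_int.mpoly_eval_canonical_poly poly_sum poly_monom
          inv_coeff_quadratic_homogeneous[of t] mult_ac intro!: sum.cong)
  next
    have "coeff ?r (Suc d) = (\<Sum>i=1..n-1. if 2 * i - 1 = Suc d then (- 1) ^ i * ?C i else 0)"
      by (simp add: coeff_sum)
    also have "\<dots> = (\<Sum>i=1..n-1. if i = n - 1 then (- 1) ^ i * ?C i else 0)"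
      using assms by (intro sum.cong) (auto simp: d_def)
    also have "\<dots> = (- 1) ^ (n - 1) * ?C (n - 1)" using assms by simp
    finally have *: "coeff ?r (Suc d) = (- 1) ^ (n - 1) * ?C (n - 1)" .
    show "coeff ?r (Suc d) \<noteq> 0"
      unfolding * using pos by auto
  qed
  ultimately show ?thesis unfolding d by (rule mpoly_degree_eqI)
qed

text \<open>Now \<open>y_3 = - 1\<close> is fixed and only \<open>y_2\<close> varies with
  \<open>t\<close>, so the exponent of the summand is \<open>i\<close> and the same Catalan number
  is the top coefficient.\<close>

lemma mpoly_degree_in_canonical_poly:
  assumes "n \<ge> 2"
  shows "mpoly_degree_in 2 (canonical_poly n :: int mpoly) = n - 1"
proof -
  let ?P = "canonical_poly n :: int mpoly"
  let ?C = "inv_coeff (\<lambda>j. if j = 3 then - 1 else 0) :: nat \<Rightarrow> real"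
  let ?a = "\<lambda>i::nat. if i = 2 then 1 else if i = 3 then - 1 else 0 :: real"
  let ?w = "\<lambda>i::nat. if i = 2 then 1 else 0 :: nat"
  let ?r = "\<Sum>i=1..n-1. Polynomial.monom ((- 1) ^ i * ?C i) i"
  define d where "d = n - 2"
  have d: "n - 1 = Suc d" using assms by (simp add: d_def)
  have "weight_le ?w (Suc d) ?P"
    using assms by (intro weight_le_canonical_poly[where e = 0]) (auto simp: d_def)
  moreover have "\<not> weight_le ?w d ?P"
  proof (rule not_weight_leI)
    fix t :: real
    have "inv_coeff (\<lambda>j. ?a j * t ^ ?w j) i = ?C i" for i
      by (rule inv_coeff_cong[of i]) auto
    then show "mpoly_eval of_int ?P (\<lambda>i. ?a i * t ^ ?w i) = poly ?r t"
      by (simp add: of_int.mpoly_eval_canonical_poly poly_sum poly_monom mult_ac)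
  next
    have "coeff ?r (Suc d) = (- 1) ^ Suc d * ?C (Suc d)"
      using d by (simp add: coeff_sum)
    then show "coeff ?r (Suc d) \<noteq> 0"
      using inv_coeff_quadratic_pos[of "Suc d"] by simp
  qed
  ultimately show ?thesis unfolding d by (rule mpoly_degree_in_eqI)
qed


section \<open>Rationality in the coordinates of the jet\<close>

text \<open>The variables \<open>y_j\<close> as functions of the point
  \<open>(x_0, ..., x_n)\<close>, in which \<open>x_j\<close> stands for the derivative of order
  \<open>j - 1\<close> when \<open>j\<close> is positive.\<close>

definition normalized_jet :: "(nat \<Rightarrow> real) \<Rightarrow> nat \<Rightarrow> real" where
  "normalized_jet x j =
     (if j = 1 then x 0 else if j = 2 then x 1 / x 2 else x j / (fact (j - 1) * x 2))"

text \<open>Allowing only powers of \<open>x 2\<close> as denominators keeps them nonzero on the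
  whole of \<open>Pi_set\<close> and still gives a class closed under sums and products.\<close>

definition rational_jet_function :: "nat \<Rightarrow> ((nat \<Rightarrow> real) \<Rightarrow> real) \<Rightarrow> bool" where
  "rational_jet_function n F \<longleftrightarrow> (\<exists>(P :: rat mpoly) N. mpoly_vars P \<subseteq> {0..n} \<and>
     (\<forall>x. x 2 \<noteq> 0 \<longrightarrow> F x = mpoly_eval of_rat P x / x 2 ^ N))"

lemma rational_jet_functionI:
  assumes "mpoly_vars (P :: rat mpoly) \<subseteq> {0..n}"
    and "\<And>x. x 2 \<noteq> 0 \<Longrightarrow> F x = mpoly_eval of_rat P x / x 2 ^ N"
  shows "rational_jet_function n F"
  using assms by (auto simp: rational_jet_function_def)

lemma rational_jet_function_const: "rational_jet_function n (\<lambda>_. of_rat r)"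
  by (rule rational_jet_functionI[of "Poly_Mapping.single 0 r" _ _ 0])
     (auto simp: mpoly_vars_def of_rat.mpoly_eval_single monom_val_def)

lemma rational_jet_function_coordinate: "i \<le> n \<Longrightarrow> rational_jet_function n (\<lambda>x. x i)"
  by (rule rational_jet_functionI[of "mvar i" _ _ 0])
     (auto simp: mpoly_vars_subset_iff of_rat.mpoly_eval_mvar intro: weight_le_mvar)

lemma rational_jet_function_inverse: "rational_jet_function n (\<lambda>x. inverse (x 2))"
  by (rule rational_jet_functionI[of 1 _ _ 1])
     (auto simp: mpoly_vars_subset_iff of_rat.mpoly_eval_1 divide_inverse)

lemma rational_jet_function_mult:
  assumes "rational_jet_function n F" "rational_jet_function n G"
  shows "rational_jet_function n (\<lambda>x. F x * G x)"
proof -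
  obtain P M where P: "mpoly_vars (P :: rat mpoly) \<subseteq> {0..n}"
    "\<And>x. x 2 \<noteq> 0 \<Longrightarrow> F x = mpoly_eval of_rat P x / x 2 ^ M"
    using assms(1) unfolding rational_jet_function_def by blast
  obtain Q N where Q: "mpoly_vars (Q :: rat mpoly) \<subseteq> {0..n}"
    "\<And>x. x 2 \<noteq> 0 \<Longrightarrow> G x = mpoly_eval of_rat Q x / x 2 ^ N"
    using assms(2) unfolding rational_jet_function_def by blast
  show ?thesis
  proof (rule rational_jet_functionI[of "P * Q" _ _ "M + N"])
    show "mpoly_vars (P * Q) \<subseteq> {0..n}"
      using P(1) Q(1) weight_le_mult[of _ 0 P 0 Q] by (simp add: mpoly_vars_subset_iff)
    show "F x * G x = mpoly_eval of_rat (P * Q) x / x 2 ^ (M + N)" if "x 2 \<noteq> 0" for x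
      using P(2) Q(2) that by (simp add: of_rat.mpoly_eval_mult power_add)
  qed
qed

lemma rational_jet_function_add:
  assumes "n \<ge> 2" "rational_jet_function n F" "rational_jet_function n G"
  shows "rational_jet_function n (\<lambda>x. F x + G x)"
proof -
  obtain P M where P: "mpoly_vars (P :: rat mpoly) \<subseteq> {0..n}"
    "\<And>x. x 2 \<noteq> 0 \<Longrightarrow> F x = mpoly_eval of_rat P x / x 2 ^ M"
    using assms(2) unfolding rational_jet_function_def by blast
  obtain Q N where Q: "mpoly_vars (Q :: rat mpoly) \<subseteq> {0..n}"
    "\<And>x. x 2 \<noteq> 0 \<Longrightarrow> G x = mpoly_eval of_rat Q x / x 2 ^ N"
    using assms(3) unfolding rational_jet_function_def by blast
  let ?w = "\<lambda>i. if i \<in> {0..n} then 0 else 1 :: nat"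
  show ?thesis
  proof (rule rational_jet_functionI[of "P * mvar 2 ^ N + Q * mvar 2 ^ M" _ _ "M + N"])
    have v: "weight_le ?w 0 (mvar 2 ^ k :: rat mpoly)" for k
      using weight_le_power[OF weight_le_mvar[of ?w 2 0], of k] assms(1) by simp
    show "mpoly_vars (P * mvar 2 ^ N + Q * mvar 2 ^ M) \<subseteq> {0..n}"
      using P(1) Q(1) weight_le_mult[of ?w 0 _ 0, OF _ v] unfolding mpoly_vars_subset_iff
      by (auto intro!: weight_le_add)
    show "F x + G x = mpoly_eval of_rat (P * mvar 2 ^ N + Q * mvar 2 ^ M) x / x 2 ^ (M + N)"
      if "x 2 \<noteq> 0" for x
      using that
      by (simp add: P(2)[of x, OF that] Q(2)[of x, OF that] of_rat.mpoly_eval_mult of_rat.mpoly_eval_add of_rat.mpoly_eval_power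
          of_rat.mpoly_eval_mvar power_add field_simps)
  qed
qed

lemma rational_jet_function_power:
  "rational_jet_function n F \<Longrightarrow> rational_jet_function n (\<lambda>x. F x ^ k)"
  using rational_jet_function_const[of n 1]
  by (induction k) (auto intro: rational_jet_function_mult)

lemma rational_jet_function_prod:
  assumes "\<And>i. i \<in> I \<Longrightarrow> rational_jet_function n (F i)"
  shows "rational_jet_function n (\<lambda>x. \<Prod>i\<in>I. F i x)"
  using assms rational_jet_function_const[of n 1]
  by (induction I rule: infinite_finite_induct) (auto intro: rational_jet_function_mult)

lemma rational_jet_function_sum:
  assumes "n \<ge> 2" "\<And>i. i \<in> I \<Longrightarrow> rational_jet_function n (F i)"
  shows "rational_jet_function n (\<lambda>x. \<Sum>i\<in>I. F i x)"
  using assms(2) rational_jet_function_const[of n 0]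
  by (induction I rule: infinite_finite_induct) (auto intro: rational_jet_function_add[OF assms(1)])

lemma rational_jet_function_normalized_jet:
  assumes "n \<ge> 2" "j \<in> {1..n}"
  shows "rational_jet_function n (\<lambda>x. normalized_jet x j)"
proof -
  have *: "rational_jet_function n (\<lambda>x. of_rat r * (x i * inverse (x 2)))" if "i \<le> n" for r i
    using that by (intro rational_jet_function_mult rational_jet_function_const
        rational_jet_function_inverse rational_jet_function_coordinate)
  consider "j = 1" | "j = 2" | "j \<noteq> 1" "j \<noteq> 2" by blast
  then show ?thesis
  proof cases
    case 1
    then show ?thesis
      using rational_jet_function_coordinate[of 0 n] by (simp add: normalized_jet_def)
  next
    case 2
    then show ?thesis
      using *[of 1 1] assms by (simp add: normalized_jet_def divide_inverse)
  next
    case 3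
    have "of_rat (inverse (fact (j - 1))) = (inverse (fact (j - 1)) :: real)"
      by (metis of_nat_fact of_rat_inverse of_rat_of_nat_eq)
    then show ?thesis
      using *[of j "inverse (fact (j - 1))"] assms 3
      by (simp add: normalized_jet_def divide_inverse mult_ac)
  qed
qed

lemma rational_jet_function_mpoly_eval:
  assumes "n \<ge> 2" "mpoly_vars P \<subseteq> {1..n}"
  shows "rational_jet_function n (\<lambda>x. mpoly_eval of_int P (normalized_jet x))"
proof -
  have "rational_jet_function n (\<lambda>x. \<Prod>i\<in>Poly_Mapping.keys m.
      normalized_jet x i ^ Poly_Mapping.lookup m i)" if "m \<in> Poly_Mapping.keys P" for m
    using assms(2) that
    by (intro rational_jet_function_prod rational_jet_function_power
        rational_jet_function_normalized_jet assms(1)) (auto simp: mpoly_vars_def)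
  moreover have "rational_jet_function n (\<lambda>x. of_int k)" for k
    using rational_jet_function_const[of n "of_int k"] by simp
  ultimately have "rational_jet_function n (\<lambda>x. \<Sum>m\<in>Poly_Mapping.keys P.
      of_int (Poly_Mapping.lookup P m) *
      (\<Prod>i\<in>Poly_Mapping.keys m. normalized_jet x i ^ Poly_Mapping.lookup m i))"
    by (intro rational_jet_function_sum[OF assms(1)]) (rule rational_jet_function_mult)
  then show ?thesis by (simp add: mpoly_eval_def)
qed


section \<open>The canonical method\<close>

lemma mpoly_eval_cong:
  assumes "\<And>i. i \<in> mpoly_vars p \<Longrightarrow> a i = b i"
  shows "mpoly_eval c p a = mpoly_eval c p b"
proof -
  have "a i = b i" if "m \<in> Poly_Mapping.keys p" "i \<in> Poly_Mapping.keys m" for m i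
    using assms that unfolding mpoly_vars_def by blast
  then show ?thesis
    unfolding mpoly_eval_def by (intro sum.cong refl arg_cong2[where f = "(*)"] prod.cong) simp
qed

section \<open>Smoothness of the local inverse\<close>

context
  fixes f g :: "real \<Rightarrow> real" and s :: real and U :: "real set" and n :: nat
  assumes f: "Ck_real n f" and n: "n \<ge> 1" and loc: "local_inverse f s U g"
begin

lemma local_inverse_open: "open U"
  and local_inverse_base: "s \<in> U"
  and local_inverse_deriv_nonzero: "x \<in> U \<Longrightarrow> deriv f x \<noteq> 0"
  and local_inverse_inverse: "x \<in> U \<Longrightarrow> g (f x) = x"
  using loc by (auto simp: local_inverse_def)

lemma local_inverse_has_derivative: "(f has_real_derivative deriv f x) (at x)"
  using Ck_on_has_real_derivative[of UNIV n f 0 x] f n by (simp add: Ck_real_iff_Ck_on)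

lemma local_inverse_continuous_on: "continuous_on S f"
  by (rule continuous_at_imp_continuous_on) (meson DERIV_isCont local_inverse_has_derivative)

lemma local_inverse_inj_on: "inj_on f U"
  by (rule inj_on_inverseI[of _ g]) (rule local_inverse_inverse)

lemma local_inverse_open_image: "open (f ` U)"
  using invariance_of_domain local_inverse_continuous_on local_inverse_open local_inverse_inj_on
  by blast

lemma local_inverse_inverse_derivative:
  assumes "y \<in> f ` U"
  shows "(g has_real_derivative inverse (deriv f (g y))) (at y)"
proof -
  obtain x where x: "x \<in> U" "y = f x" using assms by blast
  have "(g has_derivative (*) (inverse (deriv f x))) (at (f x))"
  proof (rule has_derivative_inverse_strong[OF local_inverse_open x(1) local_inverse_continuous_on
        local_inverse_inverse])
    show "(f has_derivative (*) (deriv f x)) (at x)"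
      using local_inverse_has_derivative[of x] by (simp add: has_field_derivative_def)
    show "(*) (deriv f x) \<circ> (*) (inverse (deriv f x)) = id"
      using local_inverse_deriv_nonzero[OF x(1)] by (simp add: fun_eq_iff)
  qed
  then have "(g has_real_derivative inverse (deriv f x)) (at (f x))"
    by (simp add: has_field_derivative_def)
  then show ?thesis using x by (simp add: local_inverse_inverse)
qed

text \<open>Bootstrapping through \<open>g' = 1 / f' (g)\<close>: if \<open>g\<close> is of class
  \<open>C^k\<close> and \<open>k < n\<close>, then so is the right-hand side, hence
  \<open>g\<close> is of class \<open>C^(k+1)\<close>.\<close>

lemma Ck_on_local_inverse: "Ck_on n (f ` U) g"
proof -
  have "Ck_on k (f ` U) g" if "k \<le> n" for k
    using that
  proof (induction k)
    case 0
    show ?case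
      using local_inverse_inverse_derivative
      by (auto intro!: continuous_at_imp_continuous_on dest: DERIV_isCont)
  next
    case (Suc k)
    have "Ck_on (Suc k) UNIV f"
      using f Suc.prems by (auto simp: Ck_real_iff_Ck_on simp del: Ck_on.simps intro: Ck_on_mono)
    then have "Ck_on k UNIV (deriv f)" using Ck_on_Suc_real[OF open_UNIV] by blast
    then have "Ck_on k (f ` U) (\<lambda>y. inverse (deriv f (g y)))"
      using Suc local_inverse_deriv_nonzero local_inverse_inverse
      by (intro Ck_on_inverse Ck_on_compose_real[of _ k UNIV "deriv f" g] local_inverse_open_image)
         auto
    then have "Ck_on k (f ` U) (deriv g)"
      by (rule Ck_on_cong[OF local_inverse_open_image, rotated])
         (metis DERIV_imp_deriv local_inverse_inverse_derivative)
    then show ?case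
      using local_inverse_inverse_derivative Ck_on_Suc_real[OF local_inverse_open_image]
      by (auto simp del: Ck_on.simps simp: real_differentiable_def)
  qed
  then show ?thesis by blast
qed

end

section \<open>Comparing expansions up to little-o\<close>

text \<open>The constant coefficient is the limit at \<open>c\<close>, hence 0; dividing by
  \<open>u - c\<close> then lowers both the polynomial and the exponent.\<close>

lemma coeff_eq_0_if_smallo:
  fixes q :: "real poly"
  assumes "((\<lambda>u. poly q (u - c) / (u - c) ^ N) \<longlongrightarrow> 0) (at c)" "k \<le> N"
  shows "coeff q k = 0"
  using assms
proof (induction q arbitrary: N k)
  case (pCons a q)
  have "((\<lambda>u. poly (pCons a q) (u - c) / (u - c) ^ N * (u - c) ^ N) \<longlongrightarrow> 0 * (c - c) ^ N) (at c)"
    by (intro tendsto_intros pCons.prems)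
  then have "((\<lambda>u. poly (pCons a q) (u - c)) \<longlongrightarrow> 0 * (c - c) ^ N) (at c)"
    by (rule Lim_transform_eventually) (auto simp: eventually_at_filter)
  moreover have "((\<lambda>u. poly (pCons a q) (u - c)) \<longlongrightarrow> poly (pCons a q) (c - c)) (at c)"
    by (intro tendsto_intros)
  ultimately have a: "a = 0"
    using tendsto_unique[OF trivial_limit_at] by force
  show ?case
  proof (cases k)
    case 0
    then show ?thesis using a by simp
  next
    case (Suc k')
    then obtain N' where N: "N = Suc N'" using pCons.prems(2) by (cases N) auto
    have "((\<lambda>u. poly q (u - c) / (u - c) ^ N') \<longlongrightarrow> 0) (at c)"
      by (rule Lim_transform_eventually[OF pCons.prems(1)])
         (auto simp: eventually_at_filter a N)
    from pCons.IH[OF this, of k'] show ?thesis using pCons.prems(2) Suc N by simp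
  qed
qed simp

text \<open>Induction via \<open>a^(i+1) - b^(i+1) = a * (a^i - b^i) + b^i * (a - b)\<close>. It
  allows an increment to be replaced by its Taylor polynomial inside powers.\<close>

lemma smallo_power_diff:
  fixes a b :: "'a \<Rightarrow> real"
  assumes "(\<lambda>u. a u - b u) \<in> o[F](h)" "a \<in> O[F](\<lambda>_. 1)" "b \<in> O[F](\<lambda>_. 1)"
  shows "(\<lambda>u. a u ^ i - b u ^ i) \<in> o[F](h)"
proof (induction i)
  case (Suc i)
  have bi: "(\<lambda>u. b u ^ i) \<in> O[F](\<lambda>_. 1)"
    using landau_o.big_power[OF assms(3), of i] by simp
  have "(\<lambda>u. a u * (a u ^ i - b u ^ i)) \<in> o[F](\<lambda>u. 1 * h u)"
    by (rule landau_o.big_small_mult[OF assms(2) Suc])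
  moreover have "(\<lambda>u. b u ^ i * (a u - b u)) \<in> o[F](\<lambda>u. 1 * h u)"
    by (rule landau_o.big_small_mult[OF bi assms(1)])
  ultimately have "(\<lambda>u. a u * (a u ^ i - b u ^ i) + b u ^ i * (a u - b u)) \<in> o[F](\<lambda>u. 1 * h u)"
    by (rule sum_in_smallo)
  then show ?case by (simp add: algebra_simps)
qed simp

lemma smallo_Taylor:
  fixes f :: "real \<Rightarrow> real"
  assumes "open S" "Ck_on k S f" "c \<in> S"
  shows "(\<lambda>x. f x - (\<Sum>m\<le>k. (deriv ^^ m) f c / fact m * (x - c) ^ m)) \<in> o[at c](\<lambda>x. (x - c) ^ k)"
  by (rule smalloI_tendsto[OF Taylor_Peano[OF assms]])
     (rule eventually_mono[OF eventually_neq_at_within[of c]], simp)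

text \<open>Both sides of \<open>g (f u) = u\<close> are expanded at \<open>x\<close> up to order \<open>n - 1\<close>; comparing
  coefficients gives the recursion that defines \<open>inv_coeff\<close>.\<close>

lemma deriv_local_inverse_eq_inv_coeff:
  assumes f: "Ck_real n f" and n: "n \<ge> 2" and loc: "local_inverse f s U g" and x: "x \<in> U"
    and i: "1 \<le> i" "i \<le> n - 1"
  shows "(deriv ^^ i) g (f x) / fact i * deriv f x ^ i =
    inv_coeff (\<lambda>j. (deriv ^^ (j - 1)) f x / (fact (j - 1) * deriv f x)) i"
proof -
  define N where "N = n - 1"
  have n1: "n \<ge> 1" using n by simp
  note L = f n1 loc
  define d where "d = deriv f x"
  define z where "z j = (deriv ^^ (j - 1)) f x / (fact (j - 1) * d)" for j
  \<comment> \<open>\<phi> is \<open>gen_series z\<close> truncated at degree \<open>N\<close>, so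
    \<open>b\<close> below is the Taylor polynomial of the increment \<open>a\<close>. The numbers
    \<open>C i\<close> are to be recognised as the inverse coefficients.\<close>
  define \<phi> where "\<phi> = (\<Sum>j=1..N. Polynomial.monom (if j = 1 then 1 else z (Suc j)) j)"
  define C where "C i = (if i = 0 then 0 else (deriv ^^ i) g (f x) / fact i * d ^ i)" for i
  define a where "a u = f u - f x" for u
  define b where "b u = d * poly \<phi> (u - x)" for u
  have d: "d \<noteq> 0" unfolding d_def by (rule local_inverse_deriv_nonzero[OF L x])
  have fN: "Ck_on N UNIV f" using f n
    by (auto simp: Ck_real_iff_Ck_on N_def intro: Ck_on_mono)
  have gN: "Ck_on N (f ` U) g"
    using Ck_on_local_inverse[OF L] by (rule Ck_on_mono) (simp add: N_def)

  have "(\<Sum>m\<le>N. (deriv ^^ m) f x / fact m * (u - x) ^ m) = f x + b u" for u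
  proof -
    have "(\<Sum>m\<le>N. (deriv ^^ m) f x / fact m * (u - x) ^ m) =
        f x + (\<Sum>m=1..N. (deriv ^^ m) f x / fact m * (u - x) ^ m)"
      by (simp add: sum.atMost_shift sum.atLeast1_atMost_eq)
    also have "(\<Sum>m=1..N. (deriv ^^ m) f x / fact m * (u - x) ^ m) = b u"
      unfolding b_def \<phi>_def poly_sum poly_monom sum_distrib_left
      by (rule sum.cong) (use d in \<open>auto simp: z_def d_def\<close>)
    finally show ?thesis .
  qed
  with smallo_Taylor[OF open_UNIV fN UNIV_I, of x]
  have ab: "(\<lambda>u. a u - b u) \<in> o[at x](\<lambda>u. (u - x) ^ N)"
    by (simp add: a_def algebra_simps)

  have a_lim: "((\<lambda>u. a u / (u - x)) \<longlongrightarrow> d) (at x)"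
    using local_inverse_has_derivative[OF L, of x] by (simp add: has_field_derivative_iff a_def d_def)
  have a_bigo: "a \<in> O[at x](\<lambda>u. u - x)"
    by (rule bigoI_tendsto[OF a_lim]) (auto simp: eventually_at_filter)
  have "a \<midarrow>x\<rightarrow> 0"
    using local_inverse_continuous_on[OF L, of UNIV] unfolding a_def
    by (simp add: continuous_on_eq_continuous_at isCont_def LIM_zero_iff)
  then have a1: "a \<in> O[at x](\<lambda>_. 1)" by (intro bigoI_tendsto[of _ _ 0]) auto
  have "(\<lambda>u. b u) \<midarrow>x\<rightarrow> d * poly \<phi> (x - x)"
    unfolding b_def by (intro tendsto_intros)
  then have b1: "b \<in> O[at x](\<lambda>_. 1)" by (intro bigoI_tendsto[where c = "d * poly \<phi> (x - x)"]) auto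

  have evU: "\<forall>\<^sub>F u in at x. u \<in> U - {x}"
    using local_inverse_open[OF L] x eventually_at_in_open by blast
  \<comment> \<open>The little-o expansion of \<open>g\<close> lives on a punctured neighbourhood of
    \<open>f x\<close>, so composing it with \<open>f\<close> requires
    \<open>f u \<noteq> f x\<close>; injectivity provides this.\<close>
  have "filterlim f (at (f x)) (at x)"
    unfolding filterlim_at
  proof
    show "\<forall>\<^sub>F u in at x. f u \<in> UNIV \<and> f u \<noteq> f x"
      using evU by eventually_elim (use local_inverse_inj_on[OF L] x in \<open>auto simp: inj_on_def\<close>)
    show "(f \<longlongrightarrow> f x) (at x)"
      using local_inverse_continuous_on[OF L, of UNIV]
      by (simp add: continuous_on_eq_continuous_at isCont_def)
  qed
  from landau_o.small.compose[OF smallo_Taylor[OF local_inverse_open_image[OF L] gN] this] x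
  have "(\<lambda>u. g (f u) - (\<Sum>m\<le>N. (deriv ^^ m) g (f x) / fact m * a u ^ m)) \<in> o[at x](\<lambda>u. a u ^ N)"
    by (simp add: a_def)
  also have "(\<lambda>u. a u ^ N) \<in> O[at x](\<lambda>u. (u - x) ^ N)"
    by (rule landau_o.big_power[OF a_bigo])
  also have "(\<lambda>u. g (f u) - (\<Sum>m\<le>N. (deriv ^^ m) g (f x) / fact m * a u ^ m)) \<in>
      o[at x](\<lambda>u. (u - x) ^ N) \<longleftrightarrow>
    (\<lambda>u. (u - x) - (\<Sum>m=1..N. (deriv ^^ m) g (f x) / fact m * a u ^ m)) \<in>
      o[at x](\<lambda>u. (u - x) ^ N)"
  proof (rule landau_o.small.in_cong)
    show "\<forall>\<^sub>F u in at x. g (f u) - (\<Sum>m\<le>N. (deriv ^^ m) g (f x) / fact m * a u ^ m) =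
      (u - x) - (\<Sum>m=1..N. (deriv ^^ m) g (f x) / fact m * a u ^ m)"
      using evU
    proof eventually_elim
      case (elim u)
      then show ?case
        using x local_inverse_inverse[OF L]
        by (simp add: sum.atMost_shift sum.atLeast1_atMost_eq)
    qed
  qed
  finally have "(\<lambda>u. (u - x) - (\<Sum>m=1..N. (deriv ^^ m) g (f x) / fact m * a u ^ m)) \<in>
      o[at x](\<lambda>u. (u - x) ^ N)" .
  \<comment> \<open>Replacing \<open>a\<close> by the polynomial \<open>b\<close> in every power
    changes the sum only by a little-o term.\<close>
  moreover have "(\<lambda>u. \<Sum>m=1..N. (deriv ^^ m) g (f x) / fact m * (a u ^ m - b u ^ m)) \<in>
      o[at x](\<lambda>u. (u - x) ^ N)"
    by (intro big_sum_in_smallo landau_o.small.cmult_in_iff'[THEN iffD2]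
        smallo_power_diff ab a1 b1)
       (use smallo_power_diff[OF ab a1 b1] in auto)
  ultimately have "(\<lambda>u. (u - x) - (\<Sum>m=1..N. (deriv ^^ m) g (f x) / fact m * a u ^ m) +
      (\<Sum>m=1..N. (deriv ^^ m) g (f x) / fact m * (a u ^ m - b u ^ m))) \<in> o[at x](\<lambda>u. (u - x) ^ N)"
    by (rule sum_in_smallo)
  then have "(\<lambda>u. (u - x) - (\<Sum>m=1..N. (deriv ^^ m) g (f x) / fact m * b u ^ m)) \<in>
      o[at x](\<lambda>u. (u - x) ^ N)"
    by (simp only: right_diff_distrib sum_subtractf add_diff_eq diff_add_cancel)
  \<comment> \<open>The powers of \<open>d\<close> contained in \<open>b\<close> are absorbed into
    \<open>C\<close>, leaving a polynomial in \<open>u - x\<close> that must vanish up to degree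
    \<open>N\<close>.\<close>
  moreover define q where "q = Polynomial.monom 1 1 - (\<Sum>i=1..N. smult (C i) (\<phi> ^ i))"
  have "poly q (u - x) = (u - x) - (\<Sum>m=1..N. (deriv ^^ m) g (f x) / fact m * b u ^ m)" for u
    by (simp add: q_def poly_monom poly_sum C_def b_def power_mult_distrib mult_ac)
  ultimately have "(\<lambda>u. poly q (u - x)) \<in> o[at x](\<lambda>u. (u - x) ^ N)" by simp
  then have q0: "coeff q k = 0" if "k \<le> N" for k
    by (intro coeff_eq_0_if_smallo[OF smalloD_tendsto that])

  have "C i = inv_coeff z i"
  proof (rule inv_coeff_unique)
    fix k assume k: "k \<le> N"
    have "N \<ge> 1" using n by (simp add: N_def)
    \<comment> \<open>The cutoff is at \<open>Suc N\<close> because the coefficient of index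
      \<open>j\<close> is \<open>z (Suc j)\<close>.\<close>
    then have "fps_of_poly \<phi> = gen_series (\<lambda>j. if j \<le> Suc N then z j else 0)"
      by (auto simp: fps_eq_iff gen_series_def \<phi>_def coeff_sum)
    then have \<phi>: "coeff (\<phi> ^ i) k = fps_nth (gen_series z ^ i) k" for i
      using gen_series_power_cong[of N "\<lambda>j. if j \<le> Suc N then z j else 0" z k i] k
      by (simp add: fps_of_poly_power flip: fps_of_poly_nth)
    have "(if k = 1 then 1 else 0) = (\<Sum>i=1..N. C i * coeff (\<phi> ^ i) k)"
      using q0[OF k] by (cases "k = 1") (simp_all add: q_def coeff_sum)
    also have "\<dots> = (\<Sum>i\<le>k. C i * fps_nth (gen_series z ^ i) k)"
      unfolding \<phi> using k
      \<comment> \<open>The ranges differ by \<open>i = 0\<close>, where \<open>C\<close> is 0 by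
        definition, and by \<open>i > k\<close>, where the power of the series starts too
        late.\<close>
      by (intro sum.mono_neutral_cong) (auto simp: C_def gen_series_power_nth(1))
    finally show "(\<Sum>i\<le>k. C i * fps_nth (gen_series z ^ i) k) = (if k = 1 then 1 else 0)" ..
  qed (use i in \<open>simp add: N_def\<close>)
  then show ?thesis using i by (simp add: C_def d_def z_def[abs_def])
qed

lemma canonical_method_eq_mpoly_eval:
  assumes "Ck_real n f" "n \<ge> 2" "local_inverse f s U g" "x \<in> U"
  shows "canonical_method n f g x = mpoly_eval of_int (canonical_poly n)
    (\<lambda>j. if j = 1 then x else if j = 2 then f x / deriv f x
      else (deriv ^^ (j - 1)) f x / (fact (j - 1) * deriv f x))"
    (is "_ = mpoly_eval _ _ ?a")
proof -
  have "(- 1) ^ i / fact i * f x ^ i * (deriv ^^ i) g (f x) = (- 1) ^ i * (?a 2 ^ i * inv_coeff ?a i)"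
    if i: "i \<in> {1..n-1}" for i
  proof -
    \<comment> \<open>The special values of \<open>?a\<close> at 1 and 2 are harmless, since
      \<open>inv_coeff\<close> reads only indices from 3 on.\<close>
    have "inv_coeff ?a i = inv_coeff (\<lambda>j. (deriv ^^ (j - 1)) f x / (fact (j - 1) * deriv f x)) i"
      by (rule inv_coeff_cong) auto
    also have "\<dots> = (deriv ^^ i) g (f x) / fact i * deriv f x ^ i"
      using deriv_local_inverse_eq_inv_coeff[OF assms, of i] i by simp
    finally have "inv_coeff ?a i = (deriv ^^ i) g (f x) / fact i * deriv f x ^ i" .
    moreover have "deriv f x \<noteq> 0" using assms(3,4) by (auto simp: local_inverse_def)
    ultimately show ?thesis by (simp add: power_divide)
  qed
  then show ?thesis
    unfolding canonical_method_def of_int.mpoly_eval_canonical_poly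
    by (intro arg_cong2[where f = "(+)"] sum.cong) auto
qed

text \<open>This is \<open>H^n\<close>: going through \<open>P^n\<close> makes it visibly
  independent of \<open>f\<close>.\<close>

definition canonical_function :: "(nat \<Rightarrow> 'd::finite) \<Rightarrow> nat \<Rightarrow> real ^ 'd \<Rightarrow> real" where
  "canonical_function idx n v =
     mpoly_eval of_int (canonical_poly n) (normalized_jet (\<lambda>k. v $ idx k))"

lemma jet_nth:
  assumes "bij_betw idx {..n} UNIV" "k \<le> n"
  shows "jet idx n f x $ idx k = (case k of 0 \<Rightarrow> x | Suc j \<Rightarrow> (deriv ^^ j) f x)"
  using point_nth[OF assms] by (simp add: jet_def)

lemma canonical_function_jet:
  assumes "n \<ge> 2" "bij_betw idx {..n} UNIV"
  shows "canonical_function idx n (jet idx n f x) = mpoly_eval of_int (canonical_poly n)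
    (\<lambda>j. if j = 1 then x else if j = 2 then f x / deriv f x
      else (deriv ^^ (j - 1)) f x / (fact (j - 1) * deriv f x))"
  unfolding canonical_function_def
proof (rule mpoly_eval_cong)
  fix j assume "j \<in> mpoly_vars (canonical_poly n :: int mpoly)"
  then have "j \<in> {1..n}" using mpoly_vars_canonical_poly[OF assms(1)] by blast
  moreover have "jet idx n f x $ idx 0 = x" "jet idx n f x $ idx 1 = f x"
    "jet idx n f x $ idx 2 = deriv f x"
    using assms by (simp_all add: jet_nth numeral_2_eq_2)
  moreover have "jet idx n f x $ idx j = (deriv ^^ (j - 1)) f x" if "j \<in> {1..n}"
    using assms(2) that by (cases j) (auto simp: jet_nth)
  ultimately show "normalized_jet (\<lambda>k. jet idx n f x $ idx k) j =
     (if j = 1 then x else if j = 2 then f x / deriv f x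
      else (deriv ^^ (j - 1)) f x / (fact (j - 1) * deriv f x))"
    by (auto simp: normalized_jet_def)
qed

lemma canonical_method_eq_canonical_function:
  assumes "Ck_real n f" "n \<ge> 2" "local_inverse f s U g" "x \<in> U" "bij_betw idx {..n} UNIV"
  shows "canonical_method n f g x = canonical_function idx n (jet idx n f x)"
  using canonical_method_eq_mpoly_eval[OF assms(1-4)] canonical_function_jet[OF assms(2,5)] by simp

lemma canonical_function_rational:
  assumes "n \<ge> 2"
  shows "\<exists>P Q :: rat mpoly. mpoly_vars P \<subseteq> {0..n} \<and> mpoly_vars Q \<subseteq> {0..n} \<and>
    (\<forall>v\<in>Pi_set idx. mpoly_eval of_rat Q (\<lambda>k. v $ idx k) \<noteq> 0 \<and> canonical_function idx n v =
      mpoly_eval of_rat P (\<lambda>k. v $ idx k) / mpoly_eval of_rat Q (\<lambda>k. v $ idx k))"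
proof -
  obtain P N where P: "mpoly_vars (P :: rat mpoly) \<subseteq> {0..n}"
    "\<And>x. x 2 \<noteq> 0 \<Longrightarrow> mpoly_eval of_int (canonical_poly n) (normalized_jet x) =
      mpoly_eval of_rat P x / x 2 ^ N"
    using rational_jet_function_mpoly_eval[OF assms mpoly_vars_canonical_poly[OF assms]]
    unfolding rational_jet_function_def by blast
  have "mpoly_vars (mvar 2 ^ N :: rat mpoly) \<subseteq> {0..n}"
    using weight_le_power[OF weight_le_mvar[of "\<lambda>i. if i \<le> n then 0 else 1" 2 0], of N] assms
    by (simp add: mpoly_vars_subset_iff)
  moreover have "mpoly_eval of_rat (mvar 2 ^ N) x = x 2 ^ N" for x
    by (simp add: of_rat.mpoly_eval_power of_rat.mpoly_eval_mvar)
  ultimately show ?thesis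
    using P by (intro exI[of _ P] exI[of _ "mvar 2 ^ N"])
      (simp add: canonical_function_def Pi_set_def)
qed

lemma canonical_method_at_zero:
  assumes "local_inverse f s U g" "f s = 0"
  shows "canonical_method n f g s = s"
proof -
  have "(\<Sum>i=1..n-1. (-1) ^ i / fact i * f s ^ i * (deriv ^^ i) g (f s)) = 0"
    by (rule sum.neutral) (simp add: assms(2))
  then show ?thesis by (simp add: canonical_method_def)
qed

text \<open>Expand \<open>g\<close> at \<open>f x\<close> and evaluate at 0: the value is
  \<open>g 0 = s\<close>, the terms of order below \<open>n\<close> form the canonical method at
  \<open>x\<close>, and the Lagrange remainder is the error up to sign. The powers of
  \<open>f x / (x - s)\<close> tend to those of \<open>deriv f s\<close>.\<close>

lemma canonical_method_error:
  assumes f: "Ck_real n f" and n: "n \<ge> 1" and loc: "local_inverse f s U g" and s: "f s = 0"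
  shows "((\<lambda>x. (canonical_method n f g x - s) / (x - s) ^ n) \<longlongrightarrow>
     - ((deriv ^^ n) g 0 / fact n * (- deriv f s) ^ n)) (at s)"
proof -
  note L = f n loc
  have sU: "s \<in> U" and gs: "g 0 = s"
    using loc s by (auto simp: local_inverse_def)
  have V: "open (f ` U)" "0 \<in> f ` U"
    using local_inverse_open_image[OF L] sU s by (auto intro: rev_image_eqI)
  note g = Ck_on_local_inverse[OF L]
  \<comment> \<open>A ball is convex, so the segment from \<open>f u\<close> to 0 stays where
    \<open>g\<close> is smooth.\<close>
  obtain r where r: "r > 0" "ball 0 r \<subseteq> f ` U" using V by (meson open_contains_ball)
  have f_lim: "(f \<longlongrightarrow> 0) (at s)"
    using local_inverse_continuous_on[OF L, of UNIV] s
    by (metis continuous_on_eq_continuous_at isCont_def open_UNIV UNIV_I)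
  let ?E = "\<lambda>u. u \<in> U \<and> f u \<in> ball 0 r"
  have ev: "\<forall>\<^sub>F u in at s. ?E u"
  proof (rule eventually_conj)
    show "\<forall>\<^sub>F u in at s. u \<in> U"
      using local_inverse_open[OF L] sU eventually_at_in_open' by blast
    show "\<forall>\<^sub>F u in at s. f u \<in> ball 0 r"
      using f_lim r(1) by (metis centre_in_ball open_ball topological_tendstoD)
  qed
  have "\<forall>u\<in>Collect ?E. \<exists>\<xi>. \<bar>\<xi>\<bar> \<le> \<bar>f u\<bar> \<and>
      canonical_method n f g u - s = - ((deriv ^^ n) g \<xi> / fact n * (- f u) ^ n)"
  proof
    fix u assume u: "u \<in> Collect ?E"
    have "closed_segment (f u) 0 \<subseteq> f ` U"
      using u r by (intro order_trans[OF closed_segment_subset[OF _ _ convex_ball] r(2)]) auto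
    from Taylor_Lagrange[OF V(1) g this] obtain \<xi> where \<xi>: "\<xi> \<in> closed_segment (f u) 0"
      and *: "g 0 = (\<Sum>m<n. (deriv ^^ m) g (f u) / fact m * (0 - f u) ^ m) +
        (deriv ^^ n) g \<xi> / fact n * (0 - f u) ^ n" by blast
    have "(\<Sum>m<n. (deriv ^^ m) g (f u) / fact m * (0 - f u) ^ m) =
        g (f u) + (\<Sum>m=1..n-1. (deriv ^^ m) g (f u) / fact m * (0 - f u) ^ m)"
      using n by (cases n) (simp_all add: sum.lessThan_Suc_shift sum.atLeast1_atMost_eq
          del: sum.lessThan_Suc funpow.simps)
    also have "g (f u) = u" using u local_inverse_inverse[OF L] by simp
    also have "(\<Sum>m=1..n-1. (deriv ^^ m) g (f u) / fact m * (0 - f u) ^ m) =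
        (\<Sum>i=1..n-1. (-1) ^ i / fact i * f u ^ i * (deriv ^^ i) g (f u))"
    proof (rule sum.cong)
      fix m
      have "(0 - f u) ^ m = (-1) ^ m * f u ^ m" by (simp flip: power_mult_distrib)
      then show "(deriv ^^ m) g (f u) / fact m * (0 - f u) ^ m =
          (-1) ^ m / fact m * f u ^ m * (deriv ^^ m) g (f u)" by simp
    qed simp
    finally have "(\<Sum>m<n. (deriv ^^ m) g (f u) / fact m * (0 - f u) ^ m) = canonical_method n f g u"
      by (simp add: canonical_method_def)
    with * gs have "canonical_method n f g u - s = - ((deriv ^^ n) g \<xi> / fact n * (- f u) ^ n)"
      by simp
    moreover have "\<bar>\<xi>\<bar> \<le> \<bar>f u\<bar>" using \<xi>
      by (auto simp: closed_segment_eq_real_ivl split: if_splits)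
    ultimately show "\<exists>\<xi>. \<bar>\<xi>\<bar> \<le> \<bar>f u\<bar> \<and>
      canonical_method n f g u - s = - ((deriv ^^ n) g \<xi> / fact n * (- f u) ^ n)" by blast
  qed
  from bchoice[OF this] obtain \<xi> where \<xi>: "\<And>u. ?E u \<Longrightarrow> \<bar>\<xi> u\<bar> \<le> \<bar>f u\<bar>"
    "\<And>u. ?E u \<Longrightarrow>
      canonical_method n f g u - s = - ((deriv ^^ n) g (\<xi> u) / fact n * (- f u) ^ n)" by blast
  have "(\<xi> \<longlongrightarrow> 0) (at s)"
  proof (rule Lim_null_comparison)
    show "\<forall>\<^sub>F u in at s. norm (\<xi> u) \<le> \<bar>f u\<bar>" using ev by eventually_elim (simp add: \<xi>(1))
    show "((\<lambda>u. \<bar>f u\<bar>) \<longlongrightarrow> 0) (at s)" by (rule tendsto_rabs_zero[OF f_lim])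
  qed
  then have g_lim: "((\<lambda>u. (deriv ^^ n) g (\<xi> u)) \<longlongrightarrow> (deriv ^^ n) g 0) (at s)"
    using Ck_on_isCont[OF V(1) g order_refl V(2)] isCont_tendsto_compose by blast
  have d_lim: "((\<lambda>u. f u / (u - s)) \<longlongrightarrow> deriv f s) (at s)"
    using local_inverse_has_derivative[OF L, of s] s by (simp add: has_field_derivative_iff)
  have "((\<lambda>u. - ((deriv ^^ n) g (\<xi> u) / fact n * (- (f u / (u - s))) ^ n)) \<longlongrightarrow>
      - ((deriv ^^ n) g 0 / fact n * (- deriv f s) ^ n)) (at s)"
    by (intro tendsto_intros g_lim d_lim) simp
  then show ?thesis
  proof (rule Lim_transform_eventually)
    show "\<forall>\<^sub>F u in at s. - ((deriv ^^ n) g (\<xi> u) / fact n * (- (f u / (u - s))) ^ n) =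
        (canonical_method n f g u - s) / (u - s) ^ n"
      using ev
    proof eventually_elim
      case (elim u)
      have "(- (f u / (u - s))) ^ n = (- f u) ^ n / (u - s) ^ n"
        by (metis minus_divide_left power_divide)
      then show ?case by (simp add: \<xi>(2)[OF elim])
    qed
  qed
qed

section \<open>From the error limit to convergence and order\<close>

lemma orbit_bound:
  fixes h :: "real \<Rightarrow> real"
  assumes "\<And>x. \<bar>x - s\<bar> < r \<Longrightarrow> \<bar>h x - s\<bar> \<le> \<bar>x - s\<bar> / 2" "\<bar>x0 - s\<bar> < r"
  shows "\<bar>(h ^^ m) x0 - s\<bar> \<le> \<bar>x0 - s\<bar> * (1 / 2) ^ m" "\<bar>(h ^^ m) x0 - s\<bar> < r"
proof -
  show "\<bar>(h ^^ m) x0 - s\<bar> \<le> \<bar>x0 - s\<bar> * (1 / 2) ^ m"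
  proof (induction m)
    case (Suc m)
    have "(1 / 2 :: real) ^ m \<le> 1" by (rule power_le_one) auto
    then have "\<bar>x0 - s\<bar> * (1 / 2) ^ m \<le> \<bar>x0 - s\<bar> * 1" by (intro mult_left_mono) auto
    from order_trans[OF Suc this] have "\<bar>(h ^^ m) x0 - s\<bar> < r" using assms(2) by simp
    from assms(1)[OF this] Suc show ?case by simp
  qed simp
  also have "\<dots> \<le> \<bar>x0 - s\<bar> * 1"
    by (intro mult_left_mono power_le_one) auto
  finally show "\<bar>(h ^^ m) x0 - s\<bar> < r" using assms(2) by simp
qed

text \<open>Since \<open>n \<ge> 2\<close>, the quotient \<open>(h x - s) / (x - s)\<close> tends to
  0, so \<open>h\<close> halves distances near \<open>s\<close> and orbits converge to
  \<open>s\<close>. The error limit along an orbit that avoids \<open>s\<close> is then the limit of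
  the ratios, namely the absolute value of \<open>L\<close>.\<close>

lemma order_from_error:
  fixes h :: "real \<Rightarrow> real"
  assumes lim: "((\<lambda>x. (h x - s) / (x - s) ^ n) \<longlongrightarrow> L) (at s)" and hs: "h s = s" and n: "n \<ge> 2"
  shows "order_at_least h (real n) s" "L \<noteq> 0 \<Longrightarrow> has_order h (real n) s"
proof -
  have "((\<lambda>x. (h x - s) / (x - s) ^ n * (x - s) ^ (n - 1)) \<longlongrightarrow> L * (s - s) ^ (n - 1)) (at s)"
    by (intro tendsto_intros lim)
  then have "((\<lambda>x. (h x - s) / (x - s)) \<longlongrightarrow> L * (s - s) ^ (n - 1)) (at s)"
  proof (rule Lim_transform_eventually)
    have "(x - s) ^ n = (x - s) * (x - s) ^ (n - 1)" for x
      using n by (metis Suc_1 Suc_le_D diff_Suc_1 power_Suc)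
    then show "\<forall>\<^sub>F x in at s. (h x - s) / (x - s) ^ n * (x - s) ^ (n - 1) = (h x - s) / (x - s)"
      by (auto simp: eventually_at_filter)
  qed
  then have "((\<lambda>x. (h x - s) / (x - s)) \<longlongrightarrow> 0) (at s)" using n by (simp add: power_0_left)
  from tendstoD[OF this, of "1/2"] obtain r where r: "r > 0"
    "\<And>x. x \<noteq> s \<Longrightarrow> \<bar>x - s\<bar> < r \<Longrightarrow> \<bar>(h x - s) / (x - s)\<bar> < 1/2"
    by (auto simp: eventually_at dist_real_def)
  have half: "\<bar>h x - s\<bar> \<le> \<bar>x - s\<bar> / 2" if "\<bar>x - s\<bar> < r" for x
  proof (cases "x = s")
    case False
    then show ?thesis using r(2)[of x] that by (simp add: field_simps)
  qed (simp add: hs)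
  have near: "\<forall>\<^sub>F x in nhds s. \<bar>x - s\<bar> < r"
    using r(1) by (auto simp: eventually_nhds_metric dist_real_def)
  have orbit: "(\<lambda>m. (h ^^ m) x0) \<longlonglongrightarrow> s" if "\<bar>x0 - s\<bar> < r" for x0
  proof -
    have "(\<lambda>m. (h ^^ m) x0 - s) \<longlonglongrightarrow> 0"
    proof (rule Lim_null_comparison)
      have "norm ((h ^^ m) x0 - s) \<le> \<bar>x0 - s\<bar> * (1 / 2) ^ m" for m
        unfolding real_norm_def by (rule orbit_bound(1)[of s r h, OF half that])
      then show "\<forall>\<^sub>F m in sequentially. norm ((h ^^ m) x0 - s) \<le> \<bar>x0 - s\<bar> * (1 / 2) ^ m"
        by (rule always_eventually[OF allI])
      show "(\<lambda>m. \<bar>x0 - s\<bar> * (1 / 2) ^ m) \<longlonglongrightarrow> 0"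
        by (intro tendsto_mult_right_zero LIMSEQ_power_zero) simp
    qed
    then show ?thesis by (simp add: LIM_zero_iff)
  qed
  have suit: "suitable_method h s"
    unfolding suitable_method_def using near by eventually_elim (rule orbit)
  have "(\<lambda>m. \<bar>(h ^^ Suc m) x0 - s\<bar> / \<bar>(h ^^ m) x0 - s\<bar> powr real n) \<longlonglongrightarrow> \<bar>L\<bar>"
    if "\<bar>x0 - s\<bar> < r" "\<forall>m. (h ^^ m) x0 \<noteq> s" for x0
  proof -
    have "filterlim (\<lambda>m. (h ^^ m) x0) (at s) sequentially"
      using orbit[OF that(1)] that(2) by (auto simp: filterlim_at)
    from tendsto_rabs[OF filterlim_compose[OF lim this]]
    show ?thesis
      using that(2) by (simp add: powr_realpow abs_divide power_abs o_def)
  qed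
  then have err: "error_limit h (real n) s \<bar>L\<bar>"
    unfolding error_limit_def using near by (auto elim: eventually_mono)
  show "order_at_least h (real n) s"
    unfolding order_at_least_def using n suit err by (auto intro: exI[of _ "\<bar>L\<bar>"])
  show "has_order h (real n) s" if "L \<noteq> 0"
  proof -
    \<comment> \<open>A nonzero limit forbids \<open>h x = s\<close> close to \<open>s\<close>, so
      orbits starting near \<open>s\<close>, but not at it, never reach it. This supplies the
      nonvacuity clause of \<open>has_order\<close>.\<close>
    have "\<forall>\<^sub>F x in at s. (h x - s) / (x - s) ^ n \<noteq> 0"
      using tendsto_imp_eventually_ne[OF lim that] .
    then obtain r' where r': "r' > 0" "\<And>x. x \<noteq> s \<Longrightarrow> \<bar>x - s\<bar> < r' \<Longrightarrow> h x \<noteq> s"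
      by (force simp: eventually_at dist_real_def)
    define \<rho> where "\<rho> = min r r'"
    have "(h ^^ m) x0 \<noteq> s" if "\<bar>x0 - s\<bar> < \<rho>" "x0 \<noteq> s" for x0 m
    proof (induction m)
      case (Suc m)
      have "\<bar>(h ^^ m) x0 - s\<bar> < \<rho>"
        by (rule orbit_bound(2)[OF half that(1)]) (simp add: \<rho>_def)
      then show ?case using r'(2)[OF Suc] by (simp add: \<rho>_def)
    qed (use that in auto)
    moreover have "\<rho> > 0" using r r' by (simp add: \<rho>_def)
    ultimately have "\<forall>\<^sub>F x0 in at s. \<forall>m. (h ^^ m) x0 \<noteq> s"
      by (auto simp: eventually_at dist_real_def intro!: exI[of _ \<rho>])
    then have "\<exists>\<^sub>F x0 in at s. \<forall>m. (h ^^ m) x0 \<noteq> s"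
      by (rule eventually_frequently[OF trivial_limit_at])
    then have "\<exists>\<^sub>F x0 in nhds s. \<forall>m. (h ^^ m) x0 \<noteq> s"
      by (auto simp: frequently_def eventually_nhds_conv_at)
    then show ?thesis
      unfolding has_order_def using n suit err that by (auto intro: exI[of _ "\<bar>L\<bar>"])
  qed
qed

lemma canonical_method_order:
  assumes "Ck_real n f" "n \<ge> 2" "simple_zero f s" "local_inverse f s U g"
  shows "order_at_least (canonical_method n f g) (real n) s"
    and "(deriv ^^ n) g 0 \<noteq> 0 \<Longrightarrow> has_order (canonical_method n f g) (real n) s"
proof -
  have s: "f s = 0" "deriv f s \<noteq> 0" using assms(3) by (auto simp: simple_zero_def)
  have n1: "n \<ge> 1" using assms(2) by simp
  note O = order_from_error[OF canonical_method_error[OF assms(1) n1 assms(4) s(1)]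
      canonical_method_at_zero[OF assms(4) s(1)] assms(2)]
  show "order_at_least (canonical_method n f g) (real n) s" by (rule O(1))
  show "has_order (canonical_method n f g) (real n) s" if "(deriv ^^ n) g 0 \<noteq> 0"
    by (rule O(2)) (use s that in simp)
qed


section \<open>Class I methods\<close>

definition iterated_directional_derivative ::
  "'a::real_normed_vector \<Rightarrow> nat \<Rightarrow> ('a \<Rightarrow> real) \<Rightarrow> 'a \<Rightarrow> real" where
  "iterated_directional_derivative e i = ((\<lambda>F v. frechet_derivative F (at v) e) ^^ i)"

lemma iterated_directional_derivative_0 [simp]: "iterated_directional_derivative e 0 F = F"
  by (simp add: iterated_directional_derivative_def)

lemma iterated_directional_derivative_Suc:
  "iterated_directional_derivative e (Suc i) F v =
     frechet_derivative (iterated_directional_derivative e i F) (at v) e"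
  by (simp add: iterated_directional_derivative_def)

lemma Ck_on_iterated_directional_derivative:
  assumes "Ck_on (i + k) W F"
  shows "Ck_on k W (iterated_directional_derivative e i F)"
  using assms
proof (induction i arbitrary: k)
  case (Suc i)
  then have "Ck_on (Suc k) W (iterated_directional_derivative e i F)" by (simp del: Ck_on.simps)
  then show ?case by (simp add: iterated_directional_derivative_Suc[abs_def])
qed simp

lemma iterated_directional_derivative_line:
  assumes "Ck_on k W F" "i < k" "v + t *\<^sub>R e \<in> W"
  shows "((\<lambda>t. iterated_directional_derivative e i F (v + t *\<^sub>R e)) has_real_derivative
    iterated_directional_derivative e (Suc i) F (v + t *\<^sub>R e)) (at t)"
proof -
  let ?G = "iterated_directional_derivative e i F"
  have "Ck_on (Suc 0) W ?G"
    using assms by (intro Ck_on_iterated_directional_derivative Ck_on_mono[OF assms(1)]) auto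
  from Ck_on_SucD[OF this assms(3)]
  have G: "(?G has_derivative frechet_derivative ?G (at (v + t *\<^sub>R e))) (at (v + t *\<^sub>R e))" .
  have "((\<lambda>t. v + t *\<^sub>R e) has_derivative (\<lambda>h. h *\<^sub>R e)) (at t)"
    by (auto intro!: derivative_eq_intros)
  from has_derivative_compose[OF this G] show ?thesis
    using linear_scale[OF has_derivative_linear[OF G]]
    by (simp add: has_field_derivative_def iterated_directional_derivative_Suc mult_commute_abs)
qed

lemma Taylor_line:
  assumes "Ck_on k W F" "\<And>t. t \<in> closed_segment 0 x \<Longrightarrow> v + t *\<^sub>R e \<in> W"
  shows "\<exists>\<xi>\<in>closed_segment 0 x. F (v + x *\<^sub>R e) =
    (\<Sum>m<k. iterated_directional_derivative e m F v / fact m * x ^ m) +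
    iterated_directional_derivative e k F (v + \<xi> *\<^sub>R e) / fact k * x ^ k"
  using Taylor_closed_segment[of k 0 x "\<lambda>m t. iterated_directional_derivative e m F (v + t *\<^sub>R e)"]
    iterated_directional_derivative_line[OF assms(1)] assms(2) by simp

text \<open>Taylor's formula along the line through \<open>v\<close> in direction \<open>e\<close>,
  based at the projection of \<open>v\<close> to the hyperplane where the coordinate is 0;
  \<open>star\<close> keeps the segment inside \<open>W\<close>. The lower terms vanish, so the
  quotient is a derivative of order \<open>k\<close> at an intermediate point, which gives
  continuity across the hyperplane.\<close>

lemma quotient_by_coordinate_power:
  fixes W :: "(real ^ 'd::finite) set" and c :: 'd
  defines "e \<equiv> axis c 1"
  assumes W: "open W" and star: "\<And>v t. v \<in> W \<Longrightarrow> t \<in> {0..1} \<Longrightarrow> v - ((1 - t) * v $ c) *\<^sub>R e \<in> W"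
    and F: "Ck_on k W F"
    and zero: "\<And>v j. v \<in> W \<Longrightarrow> v $ c = 0 \<Longrightarrow> j < k \<Longrightarrow> iterated_directional_derivative e j F v = 0"
  shows "\<exists>B. continuous_on W B \<and> (\<forall>v\<in>W. F v = (v $ c) ^ k * B v) \<and>
    (\<forall>v\<in>W. v $ c = 0 \<longrightarrow> B v = iterated_directional_derivative e k F v / fact k)"
proof (intro exI conjI)
  let ?D = "iterated_directional_derivative e k F"
  define B where "B v = (if v $ c = 0 then ?D v / fact k else F v / (v $ c) ^ k)" for v
  have ec: "e $ c = 1" by (simp add: e_def axis_def)
  show "\<forall>v\<in>W. v $ c = 0 \<longrightarrow> B v = ?D v / fact k" by (simp add: B_def)
  show "\<forall>v\<in>W. F v = (v $ c) ^ k * B v"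
  proof
    fix v assume v: "v \<in> W"
    show "F v = (v $ c) ^ k * B v"
    \<comment> \<open>For \<open>k = 0\<close> the power is 1 even on the hyperplane, and there the
      claim is the definition of \<open>B\<close>.\<close>
    proof (cases "v $ c = 0 \<and> k > 0")
      case True
      then show ?thesis using zero[OF v, of 0] by simp
    qed (auto simp: B_def)
  qed
  have "\<forall>v\<in>W. \<exists>\<xi>. \<bar>\<xi>\<bar> \<le> \<bar>v $ c\<bar> \<and> B v = ?D (v - (v $ c) *\<^sub>R e + \<xi> *\<^sub>R e) / fact k"
  proof
    fix v assume v: "v \<in> W"
    show "\<exists>\<xi>. \<bar>\<xi>\<bar> \<le> \<bar>v $ c\<bar> \<and> B v = ?D (v - (v $ c) *\<^sub>R e + \<xi> *\<^sub>R e) / fact k"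
    proof (cases "v $ c = 0")
      case True
      then show ?thesis by (intro exI[of _ 0]) (simp add: B_def)
    next
      case False
      define w where "w = v - (v $ c) *\<^sub>R e"
      have seg: "w + t *\<^sub>R e \<in> W" if t: "t \<in> closed_segment 0 (v $ c)" for t
      proof -
        obtain u where "u \<in> {0..1}" "t = u * v $ c"
          using t by (auto simp: closed_segment_def)
        then show ?thesis
          using star[OF v, of u] by (simp add: w_def algebra_simps)
      qed
      have wW: "w \<in> W" using seg[of 0] by simp
      have "w $ c = 0" by (simp add: w_def ec)
      have "w + (v $ c) *\<^sub>R e = v" by (simp add: w_def)
      moreover obtain \<xi> where \<xi>: "\<xi> \<in> closed_segment 0 (v $ c)"
        and "F (w + (v $ c) *\<^sub>R e) =
          (\<Sum>m<k. iterated_directional_derivative e m F w / fact m * (v $ c) ^ m) +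
          ?D (w + \<xi> *\<^sub>R e) / fact k * (v $ c) ^ k"
        using Taylor_line[OF F seg] by blast
      moreover have "(\<Sum>m<k. iterated_directional_derivative e m F w / fact m * (v $ c) ^ m) = 0"
        using zero[OF wW \<open>w $ c = 0\<close>] by (intro sum.neutral) auto
      ultimately have "F v = ?D (w + \<xi> *\<^sub>R e) / fact k * (v $ c) ^ k" by simp
      then have "B v = ?D (w + \<xi> *\<^sub>R e) / fact k" using False by (simp add: B_def)
      moreover have "\<bar>\<xi>\<bar> \<le> \<bar>v $ c\<bar>"
        using \<xi> by (auto simp: closed_segment_eq_real_ivl split: if_splits)
      ultimately show ?thesis unfolding w_def by blast
    qed
  qed
  from bchoice[OF this] obtain \<xi> where \<xi>: "\<And>v. v \<in> W \<Longrightarrow> \<bar>\<xi> v\<bar> \<le> \<bar>v $ c\<bar>"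
    "\<And>v. v \<in> W \<Longrightarrow> B v = ?D (v - (v $ c) *\<^sub>R e + \<xi> v *\<^sub>R e) / fact k" by blast
  have D: "isCont ?D v" if "v \<in> W" for v
    using Ck_on_imp_continuous_on[OF Ck_on_iterated_directional_derivative[of k 0 W F e]] F that W
    by (simp add: continuous_on_eq_continuous_at)
  show "continuous_on W B"
  proof (intro continuous_at_imp_continuous_on ballI)
    fix v assume v: "v \<in> W"
    have evW: "\<forall>\<^sub>F u in at v. u \<in> W" using W v eventually_at_in_open' by blast
    have cv: "((\<lambda>u. u $ c) \<longlongrightarrow> v $ c) (at v)" by (intro tendsto_intros)
    have "(B \<longlongrightarrow> B v) (at v)"
    proof (cases "v $ c = 0")
      case True
      \<comment> \<open>Near the hyperplane the intermediate points are squeezed towards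
        \<open>v\<close> itself.\<close>
      have "((\<lambda>u. \<xi> u) \<longlongrightarrow> 0) (at v)"
      proof (rule Lim_null_comparison)
        show "\<forall>\<^sub>F u in at v. norm (\<xi> u) \<le> \<bar>u $ c\<bar>"
          using evW by eventually_elim (simp add: \<xi>(1))
        show "((\<lambda>u. \<bar>u $ c\<bar>) \<longlongrightarrow> 0) (at v)" using tendsto_rabs[OF cv] True by simp
      qed
      then have "((\<lambda>u. u - (u $ c) *\<^sub>R e + \<xi> u *\<^sub>R e) \<longlongrightarrow> v - (v $ c) *\<^sub>R e + 0 *\<^sub>R e) (at v)"
        by (intro tendsto_intros cv)
      then have "((\<lambda>u. u - (u $ c) *\<^sub>R e + \<xi> u *\<^sub>R e) \<longlongrightarrow> v) (at v)" using True by simp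
      from isCont_tendsto_compose[OF D[OF v] this]
      have "((\<lambda>u. ?D (u - (u $ c) *\<^sub>R e + \<xi> u *\<^sub>R e) / fact k) \<longlongrightarrow> ?D v / fact k) (at v)"
        by (intro tendsto_intros) simp_all
      then have "(B \<longlongrightarrow> ?D v / fact k) (at v)"
        by (rule Lim_transform_eventually) (use evW in eventually_elim, simp add: \<xi>(2))
      then show ?thesis using True by (simp add: B_def)
    next
      case False
      have "isCont F v"
        using Ck_on_imp_continuous_on[OF F] W v by (simp add: continuous_on_eq_continuous_at)
      then have "((\<lambda>u. F u / (u $ c) ^ k) \<longlongrightarrow> F v / (v $ c) ^ k) (at v)"
        using False by (intro tendsto_intros cv) (auto simp: isCont_def)
      moreover have "\<forall>\<^sub>F u in at v. u $ c \<noteq> 0"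
        using tendsto_imp_eventually_ne[OF cv False] .
      then have "\<forall>\<^sub>F u in at v. F u / (u $ c) ^ k = B u"
        by eventually_elim (simp add: B_def)
      ultimately have "(B \<longlongrightarrow> F v / (v $ c) ^ k) (at v)" by (rule Lim_transform_eventually)
      then show ?thesis using False by (simp add: B_def)
    qed
    then show "isCont B v" by (simp add: isCont_def)
  qed
qed

section \<open>Polynomials with a prescribed jet\<close>

lemma funpow_deriv_poly: "(deriv ^^ i) (poly p) = poly ((pderiv ^^ i) p)" for p :: "real poly"
proof (induction i arbitrary: p)
  case (Suc i)
  have "deriv (poly p) = poly (pderiv p)"
    by (rule ext) (rule DERIV_imp_deriv[OF poly_DERIV])
  then show ?case using Suc by (simp del: funpow.simps add: funpow_Suc_right)
qed simp

lemma Ck_real_poly: "Ck_real k (poly p)"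
  unfolding Ck_real_def funpow_deriv_poly
  by (auto intro: continuous_intros poly_DERIV simp: real_differentiable_def)

text \<open>The witness is the Taylor polynomial with coefficients \<open>a i / fact i\<close>,
  translated to \<open>x\<close>.\<close>

lemma poly_with_derivatives:
  fixes a :: "nat \<Rightarrow> real"
  shows "\<exists>p. \<forall>j\<le>N. (deriv ^^ j) (poly p) x = a j"
proof -
  define q where "q = (\<Sum>i\<le>N. Polynomial.monom (a i / fact i) i)"
  have "(pderiv ^^ j) (pcompose r [:-x, 1:]) = pcompose ((pderiv ^^ j) r) [:-x, 1:]" for j r
    by (induction j) (simp_all add: pderiv_pcompose pderiv_pCons)
  then have "(deriv ^^ j) (poly (pcompose q [:-x, 1:])) x = coeff ((pderiv ^^ j) q) 0" for j
    by (simp add: funpow_deriv_poly poly_pcompose poly_0_coeff_0)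
  moreover have "coeff ((pderiv ^^ j) q) 0 = a j" if "j \<le> N" for j
    using that by (simp add: coeff_higher_pderiv q_def coeff_sum pochhammer_fact[symmetric])
  ultimately show ?thesis by (intro exI[of _ "pcompose q [:-x, 1:]"]) simp
qed

lemma open_Pi_set: "open (Pi_set idx)"
  unfolding Pi_set_def by (intro open_Collect_neq continuous_intros)

lemma Ck_on_canonical_function: "Ck_on k (Pi_set idx) (canonical_function idx n)"
proof -
  have coord: "Ck_on k (Pi_set idx) (\<lambda>v. v $ idx i)" for i
    by (rule Ck_on_bounded_linear[OF open_Pi_set bounded_linear_vec_nth])
  have nz: "v $ idx 2 \<noteq> 0" if "v \<in> Pi_set idx" for v
    using that by (simp add: Pi_set_def)
  have "Ck_on k (Pi_set idx) (\<lambda>v. normalized_jet (\<lambda>k. v $ idx k) j)" for j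
  proof -
    have "Ck_on k (Pi_set idx) (\<lambda>v. v $ idx j / (fact (j - 1) * v $ idx 2))"
      using nz by (intro Ck_on_divide Ck_on_mult Ck_on_const coord open_Pi_set) simp
    moreover have "Ck_on k (Pi_set idx) (\<lambda>v. v $ idx 1 / v $ idx 2)"
      using nz by (intro Ck_on_divide coord open_Pi_set)
    ultimately show ?thesis
      using coord by (cases "j = 1"; cases "j = 2") (simp_all add: normalized_jet_def)
  qed
  then show ?thesis
    unfolding canonical_function_def[abs_def] mpoly_eval_def
    by (intro Ck_on_sum Ck_on_mult Ck_on_prod Ck_on_power Ck_on_const open_Pi_set)
qed

text \<open>Rewrites condition (c) of Class I methods as a motion along a coordinate axis, the form
  that \<open>quotient_by_coordinate_power\<close> expects.\<close>

lemma point_scale_coordinate: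
  assumes "bij_betw idx {..n} UNIV" "n \<ge> 1"
  shows "point idx n ((\<lambda>k. v $ idx k)(1 := t * v $ idx 1)) =
    v - ((1 - t) * v $ idx 1) *\<^sub>R axis (idx 1) 1"
proof (subst vec_eq_iff, rule allI)
  fix c
  obtain k where k: "k \<le> n" "c = idx k"
    using assms(1) by (metis UNIV_I atMost_iff bij_betw_imp_surj_on imageE)
  have "idx k = idx 1 \<longleftrightarrow> k = 1"
    using assms k(1) by (auto simp: bij_betw_def inj_on_eq_iff)
  then show "point idx n ((\<lambda>k. v $ idx k)(1 := t * v $ idx 1)) $ c =
      (v - ((1 - t) * v $ idx 1) *\<^sub>R axis (idx 1) 1) $ c"
    using point_nth[OF assms(1) k(1)] k(2) by (auto simp: axis_def algebra_simps)
qed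

lemma class_ID:
  assumes "class_I idx n H W"
  shows "open W" "W \<subseteq> Pi_set idx" "Gamma_set idx \<subseteq> W" "Ck_on n W H"
    and "v \<in> Gamma_set idx \<Longrightarrow> H v = v $ idx 0"
    and "Ck_real (2 * n - 2) f \<Longrightarrow> simple_zero f s \<Longrightarrow> i \<in> {1..n-1} \<Longrightarrow>
      (deriv ^^ i) (\<lambda>x. H (jet idx n f x)) s = 0"
    and "v \<in> W \<Longrightarrow> t \<in> {0..1} \<Longrightarrow> point idx n ((\<lambda>k. v $ idx k)(1 := t * v $ idx 1)) \<in> W"
  using assms openin_open_eq[OF open_Pi_set, of idx W] unfolding class_I_def by blast+

text \<open>Every coordinate of the jet of a polynomial is itself a polynomial in
  \<open>x\<close>.\<close>

lemma jet_poly_smooth: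
  assumes "bij_betw idx {..n} UNIV"
  shows "(jet idx n (poly p) \<longlongrightarrow> jet idx n (poly p) x) (at x)"
    and "b \<in> Basis \<Longrightarrow> Ck_on k UNIV (\<lambda>x. jet idx n (poly p) x \<bullet> b)"
proof -
  have *: "\<exists>q. \<forall>x. jet idx n (poly p) x $ c = poly q x" for c
  proof -
    obtain k where k: "k \<le> n" "c = idx k"
      using assms by (metis UNIV_I atMost_iff bij_betw_imp_surj_on imageE)
    show ?thesis
    proof (cases k)
      case 0
      then show ?thesis
        using jet_nth[OF assms k(1)] k(2) by (intro exI[of _ "[:0, 1:]"]) simp
    next
      case (Suc j)
      then show ?thesis
        using jet_nth[OF assms k(1)] k(2) by (intro exI[of _ "(pderiv ^^ j) p"])
          (simp add: funpow_deriv_poly del: funpow.simps)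
    qed
  qed
  show "(jet idx n (poly p) \<longlongrightarrow> jet idx n (poly p) x) (at x)"
  proof (rule vec_tendstoI)
    fix c
    obtain q where "\<And>x. jet idx n (poly p) x $ c = poly q x" using * by blast
    then show "((\<lambda>u. jet idx n (poly p) u $ c) \<longlongrightarrow> jet idx n (poly p) x $ c) (at x)"
      by (simp add: tendsto_intros)
  qed
  show "Ck_on k UNIV (\<lambda>x. jet idx n (poly p) x \<bullet> b)" if "b \<in> Basis"
  proof -
    obtain c u where "b = axis c u" "u \<in> Basis" using \<open>b \<in> Basis\<close> unfolding Basis_vec_def by blast
    then have "b = axis c 1" by simp
    moreover obtain q where "\<And>x. jet idx n (poly p) x $ c = poly q x" using * by blast
    ultimately show ?thesis
      using Ck_real_poly[of k q] by (simp add: inner_axis Ck_real_iff_Ck_on)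
  qed
qed

text \<open>Both methods approximate \<open>s\<close> up to \<open>o((u - s)\<^bsup>n-1\<^esup>)\<close> along every polynomial jet.\<close>

lemma class_I_minus_canonical_smallo:
  assumes n: "n \<ge> 2" and idx: "bij_betw idx {..n} UNIV" and H: "class_I idx n H W"
    and p: "simple_zero (poly p) s"
  shows "((\<lambda>u. (H (jet idx n (poly p) u) - canonical_function idx n (jet idx n (poly p) u)) /
    (u - s) ^ (n - 1)) \<longlongrightarrow> 0) (at s)"
proof -
  let ?\<gamma> = "jet idx n (poly p)"
  let ?F = "\<lambda>u. H (?\<gamma> u)"
  note W = class_ID(1,3,4)[OF H] and H0 = class_ID(5)[OF H]
    and H_deriv = class_ID(6)[OF H Ck_real_poly p]
  have \<gamma>0: "?\<gamma> s \<in> Gamma_set idx"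
    using p n jet_nth[OF idx, of _ "poly p" s]
    by (auto simp: Gamma_set_def Pi_set_def simple_zero_def numeral_2_eq_2)
  have "?\<gamma> s $ idx 0 = s" using jet_nth[OF idx, of 0] by simp
  with H0[OF \<gamma>0] have Fs: "?F s = s" by simp
  define S where "S = ?\<gamma> -` W"
  have S: "open S"
    unfolding S_def using W(1) jet_poly_smooth(1)[OF idx]
    by (intro open_vimage continuous_at_imp_continuous_on) (auto simp: isCont_def)
  have "Ck_on n S ?F"
    by (rule Ck_on_compose[OF S W(3) Ck_on_subset[OF jet_poly_smooth(2)[OF idx]]])
       (auto simp: S_def)
  then have "Ck_on (n - 1) S ?F" by (rule Ck_on_mono) simp
  moreover have "s \<in> S" using \<gamma>0 W(2) by (auto simp: S_def)
  \<comment> \<open>Conditions (a) and (b) say that the Taylor polynomial of \<open>?F\<close> at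
    \<open>s\<close> of degree \<open>n - 1\<close> is the constant \<open>s\<close>.\<close>
  moreover have "(\<Sum>m\<le>n-1. (deriv ^^ m) ?F s / fact m * (u - s) ^ m) = s" for u
  proof -
    have "(\<Sum>m\<le>n-1. (deriv ^^ m) ?F s / fact m * (u - s) ^ m) =
        ?F s + (\<Sum>m=1..n-1. (deriv ^^ m) ?F s / fact m * (u - s) ^ m)"
      by (simp add: sum.atMost_shift sum.atLeast1_atMost_eq)
    also have "(\<Sum>m=1..n-1. (deriv ^^ m) ?F s / fact m * (u - s) ^ m) = 0"
      by (rule sum.neutral) (simp add: H_deriv del: funpow.simps)
    finally show ?thesis using Fs by simp
  qed
  ultimately have F: "((\<lambda>u. (?F u - s) / (u - s) ^ (n - 1)) \<longlongrightarrow> 0) (at s)"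
    using Taylor_Peano[OF S, of "n - 1" ?F s] by simp
  have fn: "Ck_real n (poly p)" and n1: "n \<ge> 1" using Ck_real_poly n by auto
  obtain U g where loc: "local_inverse (poly p) s U g"
    using local_inverse_exists[OF fn n1 p] by blast
  let ?C = "canonical_method n (poly p) g"
  have "poly p s = 0" using p by (simp add: simple_zero_def)
  \<comment> \<open>The error of the canonical method has a finite limit relative to exponent
    \<open>n\<close>; the extra factor \<open>u - s\<close> makes it vanish relative to
    \<open>n - 1\<close>.\<close>
  from tendsto_mult[OF canonical_method_error[OF fn n1 loc this] LIM_zero[OF tendsto_ident_at]]
  have "((\<lambda>u. (?C u - s) / (u - s) ^ n * (u - s)) \<longlongrightarrow> 0) (at s)" by simp
  then have "((\<lambda>u. (canonical_function idx n (?\<gamma> u) - s) / (u - s) ^ (n - 1)) \<longlongrightarrow> 0) (at s)"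
  proof (rule Lim_transform_eventually)
    have "\<forall>\<^sub>F u in at s. u \<in> U - {s}"
      using local_inverse_open[OF fn n1 loc] local_inverse_base[OF fn n1 loc]
        eventually_at_in_open by blast
    then show "\<forall>\<^sub>F u in at s. (?C u - s) / (u - s) ^ n * (u - s) =
        (canonical_function idx n (?\<gamma> u) - s) / (u - s) ^ (n - 1)"
    proof eventually_elim
      case (elim u)
      have "(u - s) ^ n = (u - s) * (u - s) ^ (n - 1)"
        using n1 by (metis Suc_diff_1 Suc_le_eq One_nat_def power_Suc)
      then show ?case
        using elim canonical_method_eq_canonical_function[OF fn n loc _ idx, of u] by simp
    qed
  qed
  from tendsto_diff[OF F this] show ?thesis by (simp add: diff_divide_distrib)
qed

text \<open>Claiming all orders below \<open>i\<close> at once lets the induction hypothesis justify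
  division by the power \<open>i\<close> of the coordinate. Only order \<open>i\<close> is then new,
  and it equals \<open>fact i\<close> times the quotient \<open>B\<close> on the hyperplane.\<close>

lemma class_I_directional_derivatives_vanish:
  assumes n: "n \<ge> 2" and idx: "bij_betw idx {..n} UNIV" and H: "class_I idx n H W" and "i \<le> n"
    and "v \<in> W" "v $ idx 1 = 0" "j < i"
  shows "iterated_directional_derivative (axis (idx 1) 1) j
    (\<lambda>v. H v - canonical_function idx n v) v = 0"
  using assms(4-)
proof (induction i arbitrary: j v)
  case (Suc i)
  let ?D = "\<lambda>v. H v - canonical_function idx n v"
  let ?e = "axis (idx 1) 1"
  show ?case
  proof (cases "j = i")
    case False
    then show ?thesis using Suc by simp
  next
    case True
    note W = class_ID(1,2,4)[OF H] and star = class_ID(7)[OF H]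
    have "Ck_on n W ?D"
      by (rule Ck_on_diff[OF W(1,3) Ck_on_subset[OF Ck_on_canonical_function W(2)]])
    then have D: "Ck_on i W ?D" using Suc.prems by (auto intro: Ck_on_mono)
    have n1: "n \<ge> 1" using n by simp
    have "iterated_directional_derivative ?e m ?D w = 0" if "w \<in> W" "w $ idx 1 = 0" "m < i" for w m
      using Suc.IH[OF _ that] Suc.prems(1) by simp
    from quotient_by_coordinate_power[OF W(1) star[unfolded point_scale_coordinate[OF idx n1]] D this]
    obtain B where "continuous_on W B \<and> (\<forall>v\<in>W. ?D v = (v $ idx 1) ^ i * B v) \<and>
      (\<forall>v\<in>W. v $ idx 1 = 0 \<longrightarrow> B v = iterated_directional_derivative ?e i ?D v / fact i)" ..
    then have B: "continuous_on W B" "\<And>v. v \<in> W \<Longrightarrow> ?D v = (v $ idx 1) ^ i * B v"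
      "\<And>v. v \<in> W \<Longrightarrow> v $ idx 1 = 0 \<Longrightarrow>
        B v = iterated_directional_derivative ?e i ?D v / fact i" by auto
    \<comment> \<open>The polynomial vanishes at \<open>v $ idx 0\<close> and takes its derivatives
      there from \<open>v\<close>, so its jet passes through the arbitrary point \<open>v\<close> of
      the hyperplane.\<close>
    obtain p where p: "\<And>k. k \<le> n - 1 \<Longrightarrow>
        (deriv ^^ k) (poly p) (v $ idx 0) = (if k = 0 then 0 else v $ idx (Suc k))"
      using poly_with_derivatives[of "n - 1" "v $ idx 0" "\<lambda>k. if k = 0 then 0 else v $ idx (Suc k)"]
      by blast
    define s where "s = v $ idx 0"
    let ?\<gamma> = "jet idx n (poly p)"
    have v2: "v $ idx 2 \<noteq> 0" using Suc.prems(2) W(2) by (auto simp: Pi_set_def)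
    have ps: "poly p s = 0" "deriv (poly p) s = v $ idx 2"
      using p[of 0] p[of 1] n by (simp_all add: s_def numeral_2_eq_2)
    have sz: "simple_zero (poly p) s" using ps v2 by (simp add: simple_zero_def)
    have \<gamma>s: "?\<gamma> s = v"
    proof (subst vec_eq_iff, rule allI)
      fix c
      obtain k where k: "k \<le> n" "c = idx k"
        using idx by (metis UNIV_I atMost_iff bij_betw_imp_surj_on imageE)
      show "?\<gamma> s $ c = v $ c"
      proof (cases k)
        case (Suc l)
        then show ?thesis
          using jet_nth[OF idx k(1), of "poly p" s] k p[of l] \<open>v $ idx 1 = 0\<close>
          by (auto simp: s_def simp del: funpow.simps)
      qed (use jet_nth[OF idx k(1)] k in \<open>simp add: s_def\<close>)
    qed
    \<comment> \<open>As \<open>i < n\<close>, the factor \<open>(u - s) ^ (n - 1 - i)\<close>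
      lowers the exponent of the denominator from \<open>n - 1\<close> to \<open>i\<close>.\<close>
    have "((\<lambda>u. ?D (?\<gamma> u) / (u - s) ^ (n - 1) * (u - s) ^ (n - 1 - i)) \<longlongrightarrow>
        0 * (s - s) ^ (n - 1 - i)) (at s)"
      by (intro tendsto_intros class_I_minus_canonical_smallo[OF n idx H sz])
    then have "((\<lambda>u. (poly p u / (u - s)) ^ i * B (?\<gamma> u)) \<longlongrightarrow> 0 * (s - s) ^ (n - 1 - i)) (at s)"
    proof (rule Lim_transform_eventually)
      have "\<forall>\<^sub>F u in at s. ?\<gamma> u \<in> W"
        using jet_poly_smooth(1)[OF idx, of p s] W(1) Suc.prems(2)
        by (auto simp: \<gamma>s dest: topological_tendstoD)
      then show "\<forall>\<^sub>F u in at s. ?D (?\<gamma> u) / (u - s) ^ (n - 1) * (u - s) ^ (n - 1 - i) =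
          (poly p u / (u - s)) ^ i * B (?\<gamma> u)"
        using eventually_neq_at_within[of s]
      proof eventually_elim
        case (elim u)
        have "?\<gamma> u $ idx 1 = poly p u" using jet_nth[OF idx n1] by simp
        then have "?D (?\<gamma> u) = poly p u ^ i * B (?\<gamma> u)" using B(2)[OF elim(1)] by simp
        moreover have "(u - s) ^ (n - 1) = (u - s) ^ i * (u - s) ^ (n - 1 - i)"
          using Suc.prems(1) by (simp flip: power_add)
        ultimately show ?case using elim(2) by (simp add: power_divide)
      qed
    qed
    \<comment> \<open>The same expression has a second description of its limit; since
      \<open>v $ idx 2 \<noteq> 0\<close>, equating the two forces \<open>B v = 0\<close>.\<close>
    moreover have "((\<lambda>u. (poly p u / (u - s)) ^ i * B (?\<gamma> u)) \<longlongrightarrow> (v $ idx 2) ^ i * B v) (at s)"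
    proof (intro tendsto_intros)
      have "(poly p has_real_derivative v $ idx 2) (at s)"
        using poly_DERIV[of p s] DERIV_imp_deriv ps(2) by metis
      then show "((\<lambda>u. poly p u / (u - s)) \<longlongrightarrow> v $ idx 2) (at s)"
        by (simp add: has_field_derivative_iff ps)
      have "isCont B v"
        using B(1) W(1) Suc.prems(2) by (simp add: continuous_on_eq_continuous_at)
      moreover have "(?\<gamma> \<longlongrightarrow> v) (at s)" using jet_poly_smooth(1)[OF idx, of p s] \<gamma>s by simp
      ultimately show "((\<lambda>u. B (?\<gamma> u)) \<longlongrightarrow> B v) (at s)" by (rule isCont_tendsto_compose)
    qed
    ultimately have "(v $ idx 2) ^ i * B v = 0 * (s - s) ^ (n - 1 - i)"
      using tendsto_unique[OF trivial_limit_at] by blast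
    then have "B v = 0" using v2 by simp
    then show ?thesis using B(3) Suc.prems True by simp
  qed
qed simp

text \<open>Division is now possible with exponent \<open>n\<close>. The product of the power with
  \<open>A\<close> inherits its smoothness from the difference of the two methods, which it equals
  on \<open>W\<close>; \<open>A\<close> itself is only obtained as continuous.\<close>

lemma class_I_decomposition:
  assumes n: "n \<ge> 2" and idx: "bij_betw idx {..n} UNIV" and H: "class_I idx n H W"
  shows "\<exists>A. continuous_on W A \<and> Ck_on n W (\<lambda>v. (v $ idx 1) ^ n * A v) \<and>
    (\<forall>v\<in>W. H v = canonical_function idx n v + (v $ idx 1) ^ n * A v)"
proof -
  let ?D = "\<lambda>v. H v - canonical_function idx n v"
  note W = class_ID(1,2,4)[OF H] and star = class_ID(7)[OF H]
  have n1: "n \<ge> 1" using n by simp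
  have D: "Ck_on n W ?D"
    by (rule Ck_on_diff[OF W(1,3) Ck_on_subset[OF Ck_on_canonical_function W(2)]])
  from quotient_by_coordinate_power[OF W(1) star[unfolded point_scale_coordinate[OF idx n1]] D
      class_I_directional_derivatives_vanish[OF n idx H order_refl]]
  obtain A where "continuous_on W A \<and> (\<forall>v\<in>W. ?D v = (v $ idx 1) ^ n * A v) \<and>
    (\<forall>v\<in>W. v $ idx 1 = 0 \<longrightarrow>
      A v = iterated_directional_derivative (axis (idx 1) 1) n ?D v / fact n)" ..
  then have A: "continuous_on W A" "\<And>v. v \<in> W \<Longrightarrow> ?D v = (v $ idx 1) ^ n * A v" by auto
  have "Ck_on n W (\<lambda>v. (v $ idx 1) ^ n * A v)"
    by (rule Ck_on_cong[OF W(1) A(2) D])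
  moreover have "H v = canonical_function idx n v + (v $ idx 1) ^ n * A v" if "v \<in> W" for v
    using A(2)[OF that] by simp
  ultimately show ?thesis using A(1) by blast
qed

section \<open>The canonical method: rationality, order and universality among Class I
  methods\<close>

theorem theorem1:
  fixes n :: nat and idx :: "nat \<Rightarrow> 'd::finite"
  assumes "n \<ge> 2" and "bij_betw idx {..n} UNIV"
  shows "\<exists>Hn :: real ^ 'd \<Rightarrow> real.
    (\<forall>f s U g. Ck_real n f \<longrightarrow> simple_zero f s \<longrightarrow> local_inverse f s U g \<longrightarrow>
       (\<forall>x\<in>U. canonical_method n f g x = Hn (jet idx n f x))) \<and>
    (\<exists>P Q :: rat mpoly. mpoly_vars P \<subseteq> {0..n} \<and> mpoly_vars Q \<subseteq> {0..n} \<and>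
       (\<forall>v\<in>Pi_set idx. mpoly_eval of_rat Q (\<lambda>k. v $ idx k) \<noteq> 0 \<and>
          Hn v = mpoly_eval of_rat P (\<lambda>k. v $ idx k) / mpoly_eval of_rat Q (\<lambda>k. v $ idx k))) \<and>
    (\<exists>P :: int mpoly. mpoly_vars P \<subseteq> {1..n} \<and>
       mpoly_degree P = 2 * n - 3 \<and> mpoly_degree_in 2 P = n - 1 \<and>
       (\<forall>f s U g. Ck_real n f \<longrightarrow> simple_zero f s \<longrightarrow> local_inverse f s U g \<longrightarrow>
          (\<forall>x\<in>U. Hn (jet idx n f x) =
             mpoly_eval of_int P (\<lambda>j. if j = 1 then x
               else if j = 2 then f x / deriv f x
               else (deriv ^^ (j - 1)) f x / (fact (j - 1) * deriv f x))))) \<and>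
    (\<forall>f s U g. Ck_real (2 * n - 2) f \<longrightarrow> simple_zero f s \<longrightarrow> local_inverse f s U g \<longrightarrow>
       order_at_least (canonical_method n f g) (real n) s \<and>
       ((deriv ^^ n) g 0 \<noteq> 0 \<longrightarrow> has_order (canonical_method n f g) (real n) s)) \<and>
    (\<forall>H W. class_I idx n H W \<longrightarrow>
       (\<exists>A. continuous_on W A \<and> Ck_on n W (\<lambda>v. (v $ idx 1) ^ n * A v) \<and>
          (\<forall>v\<in>W. H v = Hn v + (v $ idx 1) ^ n * A v)))"
proof (intro exI[of _ "canonical_function idx n"] conjI)
  show "\<forall>f s U g. Ck_real n f \<longrightarrow> simple_zero f s \<longrightarrow> local_inverse f s U g \<longrightarrow>
       (\<forall>x\<in>U. canonical_method n f g x = canonical_function idx n (jet idx n f x))"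
    using canonical_method_eq_canonical_function assms by blast
  show "\<exists>P Q :: rat mpoly. mpoly_vars P \<subseteq> {0..n} \<and> mpoly_vars Q \<subseteq> {0..n} \<and>
    (\<forall>v\<in>Pi_set idx. mpoly_eval of_rat Q (\<lambda>k. v $ idx k) \<noteq> 0 \<and> canonical_function idx n v =
      mpoly_eval of_rat P (\<lambda>k. v $ idx k) / mpoly_eval of_rat Q (\<lambda>k. v $ idx k))"
    by (rule canonical_function_rational[OF assms(1)])
  show "\<exists>P :: int mpoly. mpoly_vars P \<subseteq> {1..n} \<and>
       mpoly_degree P = 2 * n - 3 \<and> mpoly_degree_in 2 P = n - 1 \<and>
       (\<forall>f s U g. Ck_real n f \<longrightarrow> simple_zero f s \<longrightarrow> local_inverse f s U g \<longrightarrow>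
          (\<forall>x\<in>U. canonical_function idx n (jet idx n f x) =
             mpoly_eval of_int P (\<lambda>j. if j = 1 then x
               else if j = 2 then f x / deriv f x
               else (deriv ^^ (j - 1)) f x / (fact (j - 1) * deriv f x))))"
    by (intro exI[of _ "canonical_poly n"] conjI allI impI ballI
        mpoly_vars_canonical_poly mpoly_degree_canonical_poly mpoly_degree_in_canonical_poly
        canonical_function_jet assms)
  show "\<forall>f s U g. Ck_real (2 * n - 2) f \<longrightarrow> simple_zero f s \<longrightarrow> local_inverse f s U g \<longrightarrow>
       order_at_least (canonical_method n f g) (real n) s \<and>
       ((deriv ^^ n) g 0 \<noteq> 0 \<longrightarrow> has_order (canonical_method n f g) (real n) s)"
  proof (intro allI impI)
    fix f s U g
    assume f: "Ck_real (2 * n - 2) f" and s: "simple_zero f s" "local_inverse f s U g"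
    \<comment> \<open>From \<open>n \<ge> 2\<close> follows \<open>n \<le> 2 * n - 2\<close>, so the
      error limit for class \<open>C^n\<close> applies.\<close>
    have "Ck_real n f"
      using f unfolding Ck_real_iff_Ck_on by (rule Ck_on_mono) (use assms(1) in simp)
    from canonical_method_order[OF this assms(1) s]
    show "order_at_least (canonical_method n f g) (real n) s \<and>
       ((deriv ^^ n) g 0 \<noteq> 0 \<longrightarrow> has_order (canonical_method n f g) (real n) s)" by blast
  qed
  show "\<forall>H W. class_I idx n H W \<longrightarrow>
       (\<exists>A. continuous_on W A \<and> Ck_on n W (\<lambda>v. (v $ idx 1) ^ n * A v) \<and>
          (\<forall>v\<in>W. H v = canonical_function idx n v + (v $ idx 1) ^ n * A v))"
    using class_I_decomposition[OF assms] by blast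
qed

end
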